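(* Let $\mathcal A$ be a unital $C^*$-algebra and let $\mathcal F\subseteq\mathcal A$ be an algebra of finite type elements. If $t_1,t_2\in\mathcal A$ are of Fredholm type, then $t_1t_2$ is of Fredholm type and $$\operatorname{ind}(t_1t_2)=\operatorname{ind}t_1+\operatorname{ind}t_2 \quad\text{in } K(\mathcal F).$$ In other words, the set of Fredholm type elements is a multiplicative semigroup with unit and $\operatorname{ind}$ is a homomorphism from it to $(K(\mathcal F),+)$.
   Context: Let $\mathcal A$ be a unital $C^*$-algebra. A subalgebra $\mathcal F\subseteq\mathcal A$ is an algebra of finite type elements if: (i) $\mathcal F$ is a self-adjoint two-sided ideal of $\mathcal A$; (ii) $\mathcal F$ has an approximate unit consisting of projections, i.e. a net $(p_\alpha)$ of projections in $\mathcal F$ with $\|f-p_\alpha f\|\to0$ and $\|f-fp_\alpha\|\to0$ for every $f\in\mathcal F$; (iii) for any projections $p,q\in\mathcal F$ there is $v\in\mathcal A$ with $vv^*=q$ and $v^*vp=0$ (so $v^*v+p$ is a projection). Projections $p,q$ are (Murray–von Neumann) equivalent, $p\sim q$, if there is $v\in\mathcal A$ with $vv^*=p$, $v^*v=q$. $\mathrm{Proj}(\mathcal F)/\sim$ is a commutative semigroup under $[p]+[q]=[p+v^*v]$ with $v$ as in (iii), and $K(\mathcal F)$ denotes its Grothendieck group. For $a\in\mathcal A$ and projections $p,q\in\mathcal A$, $a$ is invertible up to $(p,q)$ if there is $b\in\mathcal A$ with $b=(1-p)b(1-q)$, $(1-q)a(1-p)b=1-q$ and $b(1-q)a(1-p)=1-p$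 ($b$ is a $(p,q)$-inverse of $a$). $a$ is of Fredholm type if it is invertible up to $(p,q)$ for some projections $p,q\in\mathcal F$, and then $\operatorname{ind}a=[p]-[q]\in K(\mathcal F)$ (this does not depend on the choice of $p,q$). *)

theory Defs
  imports "HOL-Analysis.Analysis"
begin

(* A unital C*-algebra: a real unital Banach algebra carrying a complex structure
   given by a central element J with J*J = -1 (so that (a+ib)x := a x + b (J x)),
   with norm compatible with complex scaling, and an involution star that is
   conjugate-linear, anti-multiplicative and satisfies the C*-identity. *)
definition cstar_algebra :: "('a::{real_normed_algebra_1,banach} \<Rightarrow> 'a) \<Rightarrow> bool" where
  "cstar_algebra star \<longleftrightarrow>
     (\<exists>J::'a.
        (\<forall>x. J * x = x * J) \<and> J * J = - 1 \<and> star J = - J \<and>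
        (\<forall>a b x. norm (scaleR a x + scaleR b (J * x)) = cmod (Complex a b) * norm x)) \<and>
     (\<forall>x y. star (x + y) = star x + star y) \<and>
     (\<forall>r x. star (scaleR r x) = scaleR r (star x)) \<and>
     (\<forall>x y. star (x * y) = star y * star x) \<and>
     (\<forall>x. star (star x) = x) \<and>
     (\<forall>x. norm (star x * x) = (norm x)\<^sup>2)"

definition is_proj :: "('a::ring_1 \<Rightarrow> 'a) \<Rightarrow> 'a \<Rightarrow> bool" where
  "is_proj star p \<longleftrightarrow> star p = p \<and> p * p = p"

(* self-adjoint two-sided ideal which is a (complex) subalgebra; closure under
   left/right multiplication by elements of A (in particular by J = i1) gives
   complex-linearity *)
definition sa_ideal :: "('a::real_normed_algebra_1 \<Rightarrow> 'a) \<Rightarrow> 'a set \<Rightarrow> bool" where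
  "sa_ideal star F \<longleftrightarrow>
     0 \<in> F \<and> (\<forall>x\<in>F. \<forall>y\<in>F. x + y \<in> F) \<and> (\<forall>r. \<forall>x\<in>F. scaleR r x \<in> F) \<and>
     (\<forall>a. \<forall>f\<in>F. a * f \<in> F \<and> f * a \<in> F) \<and> (\<forall>f\<in>F. star f \<in> F)"

(* Approximate unit of projections in F, the net being encoded as a proper filter
   on the algebra (a net (p_\<alpha>) corresponds to its image filter) *)
definition has_proj_approx_unit :: "('a::real_normed_algebra_1 \<Rightarrow> 'a) \<Rightarrow> 'a set \<Rightarrow> bool" where
  "has_proj_approx_unit star F \<longleftrightarrow>
     (\<exists>U::'a filter. U \<noteq> bot \<and> eventually (\<lambda>p. p \<in> F \<and> is_proj star p) U \<and>
        (\<forall>f\<in>F. ((\<lambda>p. norm (f - p * f)) \<longlongrightarrow> 0) U \<and> ((\<lambda>p. norm (f - f * p)) \<longlongrightarrow> 0) U))"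

definition finite_type_alg :: "('a::real_normed_algebra_1 \<Rightarrow> 'a) \<Rightarrow> 'a set \<Rightarrow> bool" where
  "finite_type_alg star F \<longleftrightarrow>
     sa_ideal star F \<and> has_proj_approx_unit star F \<and>
     (\<forall>p q. p \<in> F \<and> is_proj star p \<and> q \<in> F \<and> is_proj star q \<longrightarrow>
        (\<exists>v. v * star v = q \<and> star v * v * p = 0))"

definition mvn_equiv :: "('a::ring_1 \<Rightarrow> 'a) \<Rightarrow> 'a \<Rightarrow> 'a \<Rightarrow> bool" where
  "mvn_equiv star p q \<longleftrightarrow> (\<exists>v. v * star v = p \<and> star v * v = q)"

definition projF :: "('a::ring_1 \<Rightarrow> 'a) \<Rightarrow> 'a set \<Rightarrow> 'a set" where
  "projF star F = {p. p \<in> F \<and> is_proj star p}"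

definition pclass :: "('a::ring_1 \<Rightarrow> 'a) \<Rightarrow> 'a set \<Rightarrow> 'a \<Rightarrow> 'a set" where
  "pclass star F p = {q \<in> projF star F. mvn_equiv star p q}"

definition psemi :: "('a::ring_1 \<Rightarrow> 'a) \<Rightarrow> 'a set \<Rightarrow> 'a set set" where
  "psemi star F = pclass star F ` projF star F"

definition padd :: "('a::ring_1 \<Rightarrow> 'a) \<Rightarrow> 'a set \<Rightarrow> 'a set \<Rightarrow> 'a set \<Rightarrow> 'a set" where
  "padd star F X Y = (SOME Z. \<exists>p q v. p \<in> X \<and> q \<in> Y \<and> v * star v = q \<and> star v * v * p = 0 \<and>
                              Z = pclass star F (p + star v * v))"

(* Grothendieck group K(F): classes of pairs (X,Y) (standing for X - Y) *)
definition kclass :: "('a::ring_1 \<Rightarrow> 'a) \<Rightarrow> 'a set \<Rightarrow> 'a set \<Rightarrow> 'a set \<Rightarrow> ('a set \<times> 'a set) set" where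
  "kclass star F X Y = {(X', Y'). X' \<in> psemi star F \<and> Y' \<in> psemi star F \<and>
      (\<exists>Z \<in> psemi star F. padd star F (padd star F X Y') Z = padd star F (padd star F X' Y) Z)}"

definition kadd :: "('a::ring_1 \<Rightarrow> 'a) \<Rightarrow> 'a set \<Rightarrow> ('a set \<times> 'a set) set \<Rightarrow> ('a set \<times> 'a set) set
                     \<Rightarrow> ('a set \<times> 'a set) set" where
  "kadd star F K L = (SOME M. \<exists>X Y X' Y'. (X, Y) \<in> K \<and> (X', Y') \<in> L \<and>
                        M = kclass star F (padd star F X X') (padd star F Y Y'))"

definition inv_upto :: "'a::ring_1 \<Rightarrow> 'a \<Rightarrow> 'a \<Rightarrow> bool" where
  "inv_upto a p q \<longleftrightarrow> (\<exists>b. b = (1 - p) * b * (1 - q) \<and>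
                          (1 - q) * a * (1 - p) * b = 1 - q \<and> b * (1 - q) * a * (1 - p) = 1 - p)"

definition fredholm_type :: "('a::ring_1 \<Rightarrow> 'a) \<Rightarrow> 'a set \<Rightarrow> 'a \<Rightarrow> bool" where
  "fredholm_type star F a \<longleftrightarrow> (\<exists>p q. p \<in> projF star F \<and> q \<in> projF star F \<and> inv_upto a p q)"

definition findex :: "('a::ring_1 \<Rightarrow> 'a) \<Rightarrow> 'a set \<Rightarrow> 'a \<Rightarrow> ('a set \<times> 'a set) set" where
  "findex star F a = (SOME k. \<exists>p q. p \<in> projF star F \<and> q \<in> projF star F \<and> inv_upto a p q \<and>
                         k = kclass star F (pclass star F p) (pclass star F q))"

end

theory Submission
  imports Defs
begin

text \<open>If \<open>a\<close> is invertible up to \<open>(p, q)\<close>, then \<open>a * (1 - p)\<close> has a range projection \<open>1 - q'\<close>, and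
  \<open>q'\<close> is equivalent to \<open>q\<close>; enlarging \<open>p\<close> changes both entries of \<open>(p, q')\<close> by equivalent
  orthogonal summands, and replacing \<open>p\<close> by a member of the approximate unit is a perturbation of
  such an enlargement. Hence the index does not depend on the choice of \<open>(p, q)\<close>. For the product
  take \<open>p\<close> so large that \<open>t\<^sub>2 * (1 - p)\<close> and \<open>t\<^sub>1 * t\<^sub>2 * (1 - p)\<close> have range projections \<open>1 - r\<close>
  and \<open>1 - q\<close>; then \<open>t\<^sub>1\<close> maps \<open>1 - r\<close> onto \<open>1 - q\<close>, and \<open>[p] - [q] = ([r] - [q]) + ([p] - [r])\<close>.

  Range projections need \<open>1 + star k * k\<close> to be invertible for \<open>k = star E - E\<close>, and the equivalence of
  similar projections needs an inverse square root of \<open>star x * x\<close>. Both are obtained without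
  spectral theory from \<open>norm (1 - h * h) \<le> 1\<close> for self-adjoint \<open>h\<close> with \<open>norm h < 1\<close>.\<close>

section \<open>Isomorphisms between corners and their perturbation\<close>

lemma mult_eq_assoc:
  fixes x y z t :: "'a::semigroup_mult"
  shows "x * y = z \<Longrightarrow> x * (y * t) = z * t"
  by (simp add: mult.assoc[symmetric])

text \<open>Viewed as left multiplications, \<open>x\<close> carries the range of the idempotent
  \<open>r\<close> isomorphically onto the range of the idempotent \<open>s\<close>, with inverse
  \<open>y\<close>. Neither idempotent has to be self-adjoint, so this is algebraic equivalence
  rather than Murray-von Neumann equivalence.\<close>

definition corner_iso :: "'a::ring_1 \<Rightarrow> 'a \<Rightarrow> 'a \<Rightarrow> 'a \<Rightarrow> bool" where
  "corner_iso x y r s \<longleftrightarrow>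
     s * x = x \<and> x * r = x \<and> r * y = y \<and> y * s = y \<and> y * x = r \<and> x * y = s"

lemma corner_iso_sym: "corner_iso x y r s \<Longrightarrow> corner_iso y x s r"
  by (auto simp: corner_iso_def)

lemma corner_iso_trans:
  assumes "corner_iso x y r s" "corner_iso x' y' s t"
  shows "corner_iso (x' * x) (y * y') r t"
proof -
  from assms have 1: "s * x = x" "x * r = x" "r * y = y" "y * s = y" "y * x = r" "x * y = s"
    and 2: "t * x' = x'" "x' * s = x'" "s * y' = y'" "y' * t = y'" "y' * x' = s" "x' * y' = t"
    by (auto simp: corner_iso_def)
  have "y * y' * (x' * x) = y * (y' * x') * x" "x' * x * (y * y') = x' * (x * y) * y'"
    by (simp_all only: mult.assoc)
  moreover have "t * (x' * x) = (t * x') * x" "x' * x * r = x' * (x * r)"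
    "r * (y * y') = (r * y) * y'" "y * y' * t = y * (y' * t)"
    by (simp_all only: mult.assoc)
  ultimately show ?thesis
    using 1 2 by (simp add: corner_iso_def)
qed

text \<open>A right inverse is the fixed point of \<open>d \<mapsto> 1 + c * d\<close> and a left
  inverse that of \<open>d \<mapsto> 1 + d * c\<close>; both maps contract by the factor
  \<open>norm c\<close>, and associativity makes the two inverses agree.\<close>

lemma neumann_inverse:
  fixes c :: "'a::{real_normed_algebra_1,banach}"
  assumes "norm c < 1"
  obtains d where "(1 - c) * d = 1" "d * (1 - c) = 1"
proof -
  have "\<exists>!d. 1 + c * d = d"
    using assms by (intro banach_fix_type[of "norm c"])
      (auto simp: dist_norm norm_mult_ineq simp flip: right_diff_distrib)
  then obtain d where d: "1 + c * d = d" by blast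
  have "\<exists>!d. 1 + d * c = d"
    using assms by (intro banach_fix_type[of "norm c"])
      (auto simp: dist_norm norm_mult_ineq mult.commute[of "norm c"] simp flip: left_diff_distrib)
  then obtain d' where d': "1 + d' * c = d'" by blast
  have 1: "(1 - c) * d = 1" using d by (simp add: left_diff_distrib diff_eq_eq)
  have 2: "d' * (1 - c) = 1" using d' by (simp add: right_diff_distrib diff_eq_eq)
  have "d' = d" using 1 2 by (metis mult.assoc mult.left_neutral mult.right_neutral)
  with 1 2 that show ?thesis by blast
qed

text \<open>With \<open>c = y * (x - x')\<close> one has \<open>x' = x * (1 - c)\<close>. Since
  \<open>c\<close> lives in the corner of \<open>r\<close>, the inverse \<open>d\<close> of
  \<open>1 - c\<close> commutes with \<open>r\<close>, and \<open>d * y\<close> inverts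
  \<open>x'\<close>.\<close>

lemma corner_iso_perturb:
  fixes x y :: "'a::{real_normed_algebra_1,banach}"
  assumes "corner_iso x y r s" "s * x' = x'" "x' * r = x'" "norm y * norm (x - x') < 1"
  obtains y' where "corner_iso x' y' r s"
proof -
  have xy: "s * x = x" "x * r = x" "r * y = y" "y * s = y" "y * x = r" "x * y = s"
    using assms(1) by (auto simp: corner_iso_def)
  define c where "c = y * (x - x')"
  have "norm c < 1"
    using norm_mult_ineq[of y "x - x'"] assms(4) by (simp add: c_def)
  then obtain d where d: "(1 - c) * d = 1" "d * (1 - c) = 1"
    by (rule neumann_inverse)
  have "r * c = c" by (simp add: c_def xy flip: mult.assoc)
  moreover have "c * r = c" by (simp add: c_def mult.assoc left_diff_distrib xy assms(3))
  ultimately have cr: "(1 - c) * r = r * (1 - c)" by (simp add: left_diff_distrib right_diff_distrib)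
  have "r * d = d * ((1 - c) * r) * d" by (simp add: mult.assoc[symmetric] d)
  also have "\<dots> = d * r * ((1 - c) * d)" unfolding cr by (simp add: mult.assoc)
  finally have dr: "r * d = d * r" by (simp add: d)
  have "x * c = s * (x - x')" by (simp add: c_def xy flip: mult.assoc)
  then have x': "x' = x * (1 - c)" by (simp add: right_diff_distrib xy assms(2))
  have "(d * y) * x' = d * (y * x) * (1 - c)" by (simp add: x' mult.assoc)
  also have "\<dots> = d * ((1 - c) * r)" by (simp add: xy cr mult.assoc)
  also have "\<dots> = r" by (simp add: d flip: mult.assoc)
  finally have 1: "(d * y) * x' = r" .
  have "x' * (d * y) = x * ((1 - c) * d) * y" by (simp add: x' mult.assoc)
  then have 2: "x' * (d * y) = s" by (simp add: d xy)
  have "r * (d * y) = d * (r * y)" by (simp add: dr flip: mult.assoc)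
  then have "r * (d * y) = d * y" by (simp add: xy)
  with 1 2 assms have "corner_iso x' (d * y) r s"
    by (simp add: corner_iso_def mult.assoc xy)
  then show ?thesis by (rule that)
qed

text \<open>The product \<open>q' * q\<close> is a Schur complement of the block \<open>(1 - q) * (1 - q')\<close> of the identity.\<close>

lemma corner_iso_complement:
  fixes q q' z :: "'a::ring_1"
  assumes "q * q = q" "q' * q' = q'" "corner_iso ((1 - q) * (1 - q')) z (1 - q') (1 - q)"
  shows "corner_iso (q' * q) (q * q' - q * z * q') q q'"
proof -
  have a: "(1 - q') * z = z" "z * (1 - q) = z"
    and b: "z * ((1 - q) * (1 - q')) = 1 - q'" "(1 - q) * (1 - q') * z = 1 - q"
    using assms(3) by (auto simp: corner_iso_def)
  have 0: "q' * z = 0" "z * q = 0"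
    using a by (simp_all add: left_diff_distrib right_diff_distrib)
  have "z * (1 - q') = 1 - q'" using b(1) a(2) by (simp flip: mult.assoc)
  then have zq: "z * q' = z - 1 + q'" by (simp add: right_diff_distrib algebra_simps)
  have "(1 - q) * z = 1 - q" using b(2) a(1) by (simp add: mult.assoc)
  then have qz: "q * z = z - 1 + q" by (simp add: left_diff_distrib algebra_simps)
  have "q * z * q' * q = q * (z * q') * q" by (simp add: mult.assoc)
  also have "\<dots> = q * q' * q - q"
    unfolding zq by (simp add: algebra_simps assms 0)
  finally have 1: "q * z * q' * q = q * q' * q - q" .
  have "q' * (q * z) * q' = q' * q * q' - q'"
    unfolding qz by (simp add: algebra_simps assms 0)
  then have 2: "q' * q * z * q' = q' * q * q' - q'" by (simp add: mult.assoc)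
  note idem = assms(1,2) mult_eq_assoc[OF assms(1)] mult_eq_assoc[OF assms(2)]
  show ?thesis unfolding corner_iso_def
    using 1 2 by (simp add: left_diff_distrib right_diff_distrib mult.assoc idem)
qed

section \<open>Elementary consequences of the C*-axioms\<close>

locale cstar =
  fixes star :: "'a::{real_normed_algebra_1,banach} \<Rightarrow> 'a"
  assumes cstar_algebra: "cstar_algebra star"
begin

lemma star_add: "star (x + y) = star x + star y"
  and star_scaleR: "star (r *\<^sub>R x) = r *\<^sub>R star x"
  and star_mult: "star (x * y) = star y * star x"
  and star_star [simp]: "star (star x) = x"
  and norm_star_mult: "norm (star x * x) = (norm x)\<^sup>2"
  using cstar_algebra unfolding cstar_algebra_def by blast+

lemma imaginary_unit:
  obtains J where "\<And>x. J * x = x * J" "J * J = - 1" "star J = - J" "\<And>x. norm (J * x) = norm x"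
proof -
  obtain J where J: "\<And>x. J * x = x * J" "J * J = - 1" "star J = - J"
    "\<And>a b x. norm (a *\<^sub>R x + b *\<^sub>R (J * x)) = cmod (Complex a b) * norm x"
    using cstar_algebra unfolding cstar_algebra_def by blast
  have "norm (J * x) = norm x" for x
    using J(4)[of 0 x 1] by (simp add: cmod_def)
  with J that show ?thesis by blast
qed

lemma star_zero [simp]: "star 0 = 0"
  using star_scaleR[of 0 0] by simp

lemma star_minus: "star (- x) = - star x"
  using star_scaleR[of "-1" x] by simp

lemma star_diff: "star (x - y) = star x - star y"
  using star_add[of x "- y"] by (simp add: star_minus)

lemma star_one [simp]: "star 1 = 1"
  using star_mult[of "star 1" 1] by simp

lemmas star_simps = star_add star_diff star_minus star_mult star_scaleR

lemma norm_star [simp]: "norm (star x) = norm x"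
proof -
  have le: "norm y \<le> norm (star y)" for y
  proof (cases "y = 0")
    case False
    have "(norm y)\<^sup>2 \<le> norm (star y) * norm y"
      using norm_mult_ineq[of "star y" y] by (simp add: norm_star_mult)
    with False show ?thesis by (simp add: power2_eq_square)
  qed simp
  from le[of x] le[of "star x"] show ?thesis by simp
qed

lemma continuous_on_star: "continuous_on S star"
proof -
  have "bounded_linear star"
    by (rule bounded_linear_intro[of _ 1]) (auto simp: star_simps)
  then show ?thesis by (rule linear_continuous_on)
qed

section \<open>Square roots, norm estimates and positivity\<close>

lemma star_mult_eq_0: "star x * x = 0 \<Longrightarrow> x = 0"
  using norm_star_mult[of x] by simp

text \<open>Writing \<open>s = 1 - w\<close>, the equation \<open>s * s = a\<close> says that \<open>w\<close> is a fixed point of the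
  contraction \<open>w \<mapsto> (1 - a + w * w) / 2\<close> on a ball of radius less than 1.\<close>

lemma sqrt_exists:
  assumes "star a = a" "norm (1 - a) < 1"
  obtains s where "star s = s" "s * s = a" "norm (1 - s) < 1" "\<And>b. b * a = a * b \<Longrightarrow> b * s = s * b"
proof -
  define z where "z = 1 - a"
  \<comment> \<open>The smaller root of \<open>t * t - 2 * t + norm z = 0\<close>: the map
    \<open>f\<close> below preserves the ball of this radius and contracts there by this
    factor.\<close>
  define \<rho> where "\<rho> = 1 - sqrt (1 - norm z)"
  have z: "norm z < 1" "star z = z" using assms by (auto simp: z_def star_simps)
  have \<rho>: "0 \<le> \<rho>" "\<rho> < 1" using z by (auto simp: \<rho>_def)
  have \<rho>2: "(norm z + \<rho> * \<rho>) / 2 = \<rho>"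
  proof -
    have "sqrt (1 - norm z) * sqrt (1 - norm z) = 1 - norm z" using z by simp
    then show ?thesis by (simp add: \<rho>_def left_diff_distrib right_diff_distrib)
  qed
  \<comment> \<open>Self-adjointness and commutation with the commutant of \<open>z\<close> are
    closed conditions preserved by \<open>f\<close>; building them into the domain passes them on to
    the fixed point.\<close>
  define S where "S = cball 0 \<rho> \<inter> {w. star w = w} \<inter> (\<Inter>b\<in>{b. b * z = z * b}. {w. b * w = w * b})"
  have S_norm: "norm w \<le> \<rho>" and S_star: "star w = w"
    and S_commute: "b * z = z * b \<Longrightarrow> b * w = w * b" if "w \<in> S" for w b
    using that unfolding S_def by simp_all
  define f where "f w = (1/2) *\<^sub>R (z + w * w)" for w
  have fn: "norm (f w) \<le> \<rho>" if "norm w \<le> \<rho>" for w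
  proof -
    have "norm (z + w * w) \<le> norm z + norm w * norm w"
      by (rule order.trans[OF norm_triangle_ineq]) (simp add: norm_mult_ineq)
    also have "\<dots> \<le> norm z + \<rho> * \<rho>"
      using that by (simp add: mult_mono \<rho>)
    finally show ?thesis using \<rho>2 by (simp add: f_def)
  qed
  have "\<exists>!w. w \<in> S \<and> f w = w"
  proof (rule Banach_fix)
    have "closed S"
      unfolding S_def
      by (intro closed_Int closed_INT ballI closed_cball closed_Collect_eq continuous_intros
          continuous_on_star)
    then show "complete S" by (simp add: complete_eq_closed)
    have "0 \<in> S" using \<rho> by (simp add: S_def)
    then show "S \<noteq> {}" by blast
    show "f ` S \<subseteq> S"
    proof (intro image_subsetI)
      fix w assume w: "w \<in> S"
      have "b * f w = f w * b" if "b * z = z * b" for b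
      proof -
        have "b * w = w * b" using S_commute[OF w that] .
        then have "b * (w * w) = (w * w) * b" by (metis mult.assoc)
        with that show ?thesis by (simp add: f_def distrib_left distrib_right)
      qed
      moreover have "star (f w) = f w"
        using S_star[OF w] z(2) by (simp add: f_def star_simps)
      ultimately show "f w \<in> S"
        using fn[OF S_norm[OF w]] unfolding S_def by simp
    qed
    fix x y assume xy: "x \<in> S" "y \<in> S"
    have eq: "f x - f y = (1/2) *\<^sub>R (x * (x - y) + (x - y) * y)"
      by (simp add: f_def algebra_simps)
    have "norm (x * (x - y) + (x - y) * y) \<le> norm x * norm (x - y) + norm (x - y) * norm y"
      by (intro norm_triangle_mono norm_mult_ineq)
    then have "norm (f x - f y) \<le> (1/2) * (norm x * norm (x - y) + norm (x - y) * norm y)"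
      unfolding eq by simp
    also have "\<dots> = (norm x + norm y) / 2 * norm (x - y)"
      by (simp add: algebra_simps add_divide_distrib)
    also have "\<dots> \<le> \<rho> * norm (x - y)"
      using S_norm[OF xy(1)] S_norm[OF xy(2)] by (intro mult_right_mono) auto
    finally show "dist (f x) (f y) \<le> \<rho> * dist x y" by (simp add: dist_norm)
  qed (use \<rho> in auto)
  then obtain w where w: "w \<in> S" "f w = w" by blast
  have "2 *\<^sub>R w = 2 *\<^sub>R f w" using w(2) by simp
  then have "2 *\<^sub>R w = z + w * w" by (simp add: f_def)
  then have "(1 - w) * (1 - w) = a"
    by (simp add: z_def algebra_simps scaleR_2)
  moreover have "b * (1 - w) = (1 - w) * b" if "b * a = a * b" for b
    using S_commute[OF w(1), of b] that by (simp add: z_def left_diff_distrib right_diff_distrib)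
  moreover have "star (1 - w) = 1 - w" "norm (1 - (1 - w)) < 1"
    using S_norm[OF w(1)] S_star[OF w(1)] \<rho> by (auto simp: star_simps)
  ultimately show ?thesis using that by blast
qed

text \<open>If \<open>w\<close> is a square root of \<open>1 - h\<^sup>2\<close>, then \<open>h + \<i> w\<close> is unitary, so \<open>w\<close> is a contraction.\<close>

lemma norm_one_minus_square_le:
  assumes "star h = h" "norm h < 1"
  obtains w where "star w = w" "w * w = 1 - h * h" "norm w \<le> 1"
    "\<And>b. b * h = h * b \<Longrightarrow> b * w = w * b"
proof -
  have "norm (h * h) < 1"
    using norm_mult_ineq[of h h] assms(2)
    by (smt (verit) mult_le_one mult_left_le norm_ge_zero)
  moreover have "star (1 - h * h) = 1 - h * h" using assms(1) by (simp add: star_simps)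
  moreover have "1 - (1 - h * h) = h * h" by simp
  ultimately obtain w where w: "star w = w" "w * w = 1 - h * h"
    and com: "\<And>b. b * (1 - h * h) = (1 - h * h) * b \<Longrightarrow> b * w = w * b"
    by (metis sqrt_exists)
  have com': "b * w = w * b" if "b * h = h * b" for b
  proof (rule com)
    have "b * (h * h) = (h * h) * b" using that by (metis mult.assoc)
    then show "b * (1 - h * h) = (1 - h * h) * b" by (simp add: algebra_simps)
  qed
  obtain J where J: "\<And>x. J * x = x * J" "J * J = - 1" "star J = - J" "\<And>x. norm (J * x) = norm x"
    using imaginary_unit by blast
  define u where "u = h + J * w"
  have su: "star u = h - J * w" using assms w J(1)[of w] by (simp add: u_def star_simps J(3))
  have wh: "h * w = w * h" using com' by simp
  have "(J * w) * (J * w) = J * J * (w * w)" by (metis J(1) mult.assoc)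
  then have JJ: "(J * w) * (J * w) = - (w * w)" by (simp add: J(2))
  have "h * (J * w) = (J * w) * h" by (metis J(1) mult.assoc wh)
  then have "star u * u = h * h + w * w"
    unfolding su using JJ by (simp add: u_def algebra_simps)
  then have "star u * u = 1" using w by simp
  then have "(norm u)\<^sup>2 = 1" using norm_star_mult[of u] by simp
  then have nu: "norm u = 1" by (simp add: power2_eq_1_iff) (smt (verit) norm_ge_zero)
  have "2 *\<^sub>R (J * w) = u - star u" unfolding su by (simp add: u_def scaleR_2)
  then have "2 * norm (J * w) = norm (u - star u)" by (metis abs_numeral norm_scaleR)
  also have "\<dots> \<le> 2" using norm_triangle_ineq4[of u "star u"] nu by simp
  finally have "norm w \<le> 1" by (simp add: J(4))
  with w com' that show ?thesis by blast
qed

lemma norm_one_minus_square: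
  assumes "star h = h" "norm h < 1"
  shows "norm (1 - h * h) \<le> 1"
proof -
  obtain w where "w * w = 1 - h * h" "norm w \<le> 1"
    using norm_one_minus_square_le assms by blast
  then show ?thesis
    by (metis mult_le_one norm_ge_zero norm_mult_ineq order.trans)
qed

text \<open>Invertibility must yield a lower bound for \<open>h * h\<close>. Scale \<open>h\<close>
  and \<open>k\<close> to strict contractions \<open>g\<close> and \<open>m\<close> with
  \<open>g * m = e\<close>. If \<open>w\<close> is the square root of \<open>1 - m * m\<close>, then
  \<open>g * g - e * e\<close> is the square of the self-adjoint contraction \<open>g * w\<close>.
  Hence \<open>1 + e * e - g * g\<close> has norm at most 1, and dividing by
  \<open>1 + e * e\<close> gives the claim.\<close>

lemma square_near_one:
  assumes "star h = h" "h * k = 1" "k * h = 1"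
  obtains c where "c > 0" "norm (1 - c *\<^sub>R (h * h)) < 1"
proof -
  define l where "l = 1 / (norm h + 1)"
  define g where "g = l *\<^sub>R h"
  have l: "l > 0" by (simp add: l_def add_nonneg_pos)
  have g: "star g = g" "norm g < 1"
    using l assms by (auto simp: g_def star_simps l_def divide_simps add_nonneg_pos)
  define e where "e = 1 / (norm ((1 / l) *\<^sub>R k) + 1)"
  have e: "e > 0" by (simp add: e_def add_nonneg_pos)
  define m where "m = (e / l) *\<^sub>R k"
  have "star k = k" using assms by (metis star_mult star_one mult.assoc mult.left_neutral mult.right_neutral)
  then have m: "star m = m" "norm m < 1"
    using l e by (auto simp: m_def star_simps) (auto simp: e_def divide_simps add_nonneg_pos)
  have gm: "g * m = e *\<^sub>R 1" "m * g = e *\<^sub>R 1" using l assms by (simp_all add: g_def m_def)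
  obtain w where w: "star w = w" "w * w = 1 - m * m" "norm w \<le> 1"
    and wc: "\<And>b. b * m = m * b \<Longrightarrow> b * w = w * b"
    using norm_one_minus_square_le[OF m] by blast
  have gw: "g * w = w * g" using wc gm by simp
  have "norm (g * w) \<le> norm g * 1"
    using w(3) norm_mult_ineq[of g w] by (metis mult_left_mono norm_ge_zero order.trans)
  then have "norm (1 - (g * w) * (g * w)) \<le> 1"
    using g w(1) gw by (intro norm_one_minus_square) (auto simp: star_simps)
  moreover have "(g * w) * (g * w) = g * (w * w) * g" by (metis gw mult.assoc)
  moreover have "g * (1 - m * m) * g = g * g - (e * e) *\<^sub>R 1"
  proof -
    have "g * (m * m) * g = (g * m) * (m * g)" by (simp add: mult.assoc)
    also have "\<dots> = (e * e) *\<^sub>R 1" by (simp add: gm)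
    finally show ?thesis by (simp add: right_diff_distrib left_diff_distrib)
  qed
  ultimately have "norm (1 - (g * g - (e * e) *\<^sub>R 1)) \<le> 1"
    using w(2) by simp
  then have *: "norm ((1 + e * e) *\<^sub>R 1 - g * g) \<le> 1"
    by (simp add: scaleR_left_distrib diff_diff_eq2)
  define c where "c = l * l / (1 + e * e)"
  have ee: "1 + e * e > 1" using e by simp
  have "1 - c *\<^sub>R (h * h) = (1 / (1 + e * e)) *\<^sub>R ((1 + e * e) *\<^sub>R 1 - g * g)"
    using ee by (simp add: c_def g_def scaleR_diff_right)
  then have "norm (1 - c *\<^sub>R (h * h)) \<le> 1 / (1 + e * e)"
    using * ee by (simp add: divide_simps)
  also have "\<dots> < 1" using ee by simp
  finally show ?thesis using that[of c] l ee by (simp add: c_def)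
qed

lemma norm_scaled_minus_square:
  assumes "star h = h" "norm h < l"
  shows "norm ((l * l) *\<^sub>R 1 - h * h) \<le> l * l"
proof -
  have l: "l > 0" using assms(2) norm_ge_zero[of h] by linarith
  have "norm (1 - ((1/l) *\<^sub>R h) * ((1/l) *\<^sub>R h)) \<le> 1"
    using l assms by (intro norm_one_minus_square) (auto simp: star_simps)
  moreover have "(l * l) *\<^sub>R 1 - h * h = (l * l) *\<^sub>R (1 - ((1/l) *\<^sub>R h) * ((1/l) *\<^sub>R h))"
    using l by (simp add: scaleR_diff_right)
  ultimately show ?thesis using l by (simp add: mult_left_le)
qed

text \<open>If \<open>star v * v = - E\<close>, then \<open>- 2 * (E + f)\<close> with \<open>f = - v * star v\<close> is a sum of squares
  of self-adjoint elements; since \<open>f\<close> is itself such a square, \<open>norm (l + E) \<le> l\<close> for large \<open>l\<close>.\<close>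

lemma star_mult_eq_neg_proj:
  assumes v: "star v * v = - E" and E: "is_proj star E"
  shows "E = 0"
proof -
  obtain J where J: "\<And>x. J * x = x * J" "J * J = - 1" "star J = - J" "\<And>x. norm (J * x) = norm x"
    using imaginary_unit by blast
  have E': "star E = E" "E * E = E" using E by (auto simp: is_proj_def)
  have "star (v - v * E) * (v - v * E) = (1 - E) * (star v * v) * (1 - E)"
    by (simp add: star_simps E' algebra_simps)
  also have "\<dots> = 0" by (simp add: v algebra_simps E')
  finally have vE: "v * E = v" using star_mult_eq_0[of "v - v * E"] by simp
  define f where "f = - (v * star v)"
  have "v * star v * (v * star v) = v * (star v * v) * star v" by (simp add: mult.assoc)
  also have "\<dots> = - (v * E * star v)" by (simp add: v)
  finally have f: "star f = f" "f * f = f" by (simp_all add: f_def star_simps vE)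
  \<comment> \<open>Twice the real part of \<open>v\<close> and, up to sign, twice its imaginary
    part: \<open>2 * v = A - J * B\<close>. In the sum of their squares the terms
    \<open>v * v\<close> and \<open>star v * star v\<close> cancel.\<close>
  define A where "A = v + star v"
  define B where "B = J * (v - star v)"
  have "star B = - ((star v - v) * J)" by (simp add: B_def star_simps J(3))
  also have "\<dots> = B" unfolding B_def J(1)[of "v - star v"] by (simp add: left_diff_distrib)
  finally have sB: "star B = B" .
  have sA: "star A = A" by (simp add: A_def star_simps add.commute)
  have "B * B = J * J * ((v - star v) * (v - star v))" unfolding B_def by (metis J(1) mult.assoc)
  then have BB: "B * B = - ((v - star v) * (v - star v))" by (simp add: J(2))
  have "A * A + B * B = 2 *\<^sub>R (v * star v + star v * v)"
    unfolding BB by (simp add: A_def algebra_simps scaleR_2)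
  then have AB: "A * A + B * B = - (2 *\<^sub>R (f + E))" by (simp add: f_def v scaleR_diff_right scaleR_add_right)
  define l where "l = norm A + norm B + norm f + 1"
  define L where "L = l * l"
  have l: "norm A < l" "norm B < l" "norm f < l"
    by (simp_all add: l_def add_strict_increasing2 add_nonneg_pos)
  have n: "norm (L *\<^sub>R 1 - A * A) \<le> L" "norm (L *\<^sub>R 1 - B * B) \<le> L" "norm (L *\<^sub>R 1 - f * f) \<le> L"
    unfolding L_def by (intro norm_scaled_minus_square sA sB f l)+
  have "(4 * L) *\<^sub>R 1 + 2 *\<^sub>R E = (L *\<^sub>R 1 - A * A) + (L *\<^sub>R 1 - B * B) + 2 *\<^sub>R (L *\<^sub>R 1 - f * f)"
  proof -
    have "(L *\<^sub>R 1 - A * A) + (L *\<^sub>R 1 - B * B) = (2 * L) *\<^sub>R 1 - (A * A + B * B)"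
      by (simp add: scaleR_2 flip: scaleR_scaleR)
    also have "\<dots> = (2 * L) *\<^sub>R 1 + 2 *\<^sub>R (f + E)" unfolding AB by simp
    finally show ?thesis by (simp add: f scaleR_add_right scaleR_diff_right flip: scaleR_left_distrib)
  qed
  then have "norm ((4 * L) *\<^sub>R 1 + 2 *\<^sub>R E) \<le> L + L + 2 * L"
    using n by (simp only:) (intro norm_triangle_mono, simp_all)
  \<comment> \<open>Multiplication by this element scales \<open>E\<close> by
    \<open>4 * L + 2\<close>, which is more than its norm bound \<open>4 * L\<close> allows unless
    \<open>E = 0\<close>.\<close>
  then have "norm E * norm ((4 * L) *\<^sub>R 1 + 2 *\<^sub>R E) \<le> norm E * (4 * L)"
    by (intro mult_left_mono) auto
  moreover have "E * ((4 * L) *\<^sub>R 1 + 2 *\<^sub>R E) = (4 * L + 2) *\<^sub>R E"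
    by (simp add: distrib_left E' scaleR_left_distrib)
  moreover have "norm (E * ((4 * L) *\<^sub>R 1 + 2 *\<^sub>R E)) \<le> norm E * norm ((4 * L) *\<^sub>R 1 + 2 *\<^sub>R E)"
    by (rule norm_mult_ineq)
  moreover have "L \<ge> 0" by (simp add: L_def)
  ultimately have "(4 * L + 2) * norm E \<le> norm E * (4 * L)" by simp
  then have "norm E \<le> 0" by (simp add: algebra_simps)
  then show ?thesis by simp
qed

section \<open>Range projections and equivalence of similar projections\<close>

text \<open>The element \<open>E = c * y'\<close> is an idempotent with the range of
  \<open>c\<close>. Kaplansky's formula \<open>E * star E * w\<close>, with \<open>w\<close> the
  inverse of \<open>z = 1 + (E - star E) * (star E - E)\<close>, gives the self-adjoint projection
  onto the same range; it works because \<open>z\<close> commutes with \<open>E\<close> and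
  \<open>star E\<close>.\<close>

lemma range_projection:
  assumes "y * c = r" "c * r = c"
  obtains R S where "is_proj star R" "corner_iso c S r R"
proof -
  obtain J where J: "\<And>x. J * x = x * J" "J * J = - 1" "star J = - J" "\<And>x. norm (J * x) = norm x"
    using imaginary_unit by blast
  have rr: "r * r = r" using assms by (metis mult.assoc)
  define y' where "y' = r * y"
  have y': "y' * c = r" "r * y' = y'" using assms rr by (simp_all add: y'_def mult.assoc mult_eq_assoc[OF rr])
  define E where "E = c * y'"
  have "E * E = c * (y' * c) * y'" by (simp add: E_def mult.assoc)
  then have EE: "E * E = E" by (simp add: y' assms(2) E_def)
  have sEE: "star E * star E = star E" using EE by (metis star_mult)
  define z where "z = 1 + (E - star E) * (star E - E)"
  have sz: "star z = z" by (simp add: z_def star_simps)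
  note idem = EE sEE mult_eq_assoc[OF EE] mult_eq_assoc[OF sEE]
  have Ez: "E * z = E * star E * E" "z * E = E * star E * E"
    by (simp_all add: z_def algebra_simps idem)
  have sEz: "star E * z = star E * E * star E" "z * star E = star E * E * star E"
    using arg_cong[OF Ez(2), of star] arg_cong[OF Ez(1), of star] by (simp_all add: star_simps sz mult.assoc)
  define h where "h = J * (E - star E)"
  have "star h = - ((star E - E) * J)" by (simp add: h_def star_simps J(3))
  also have "\<dots> = h" unfolding h_def J(1)[of "E - star E"] by (simp add: left_diff_distrib)
  finally have sh: "star h = h" .
  have "h * h = J * J * ((E - star E) * (E - star E))" unfolding h_def by (metis J(1) mult.assoc)
  then have zh: "z = 1 + h * h" by (simp add: J(2) z_def algebra_simps)
  \<comment> \<open>The difference \<open>1 - z / (L + 1)\<close> equals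
    \<open>(L - h * h) / (L + 1)\<close>, whose norm is at most \<open>L / (L + 1) < 1\<close>; so
    \<open>neumann_inverse\<close> applies to the rescaled \<open>z\<close>.\<close>
  define l where "l = norm h + 1"
  define L where "L = l * l"
  have L: "L \<ge> 0" by (simp add: L_def)
  have "norm (L *\<^sub>R 1 - h * h) \<le> L"
    unfolding L_def by (intro norm_scaled_minus_square sh) (simp add: l_def)
  moreover have "1 - (1 / (L + 1)) *\<^sub>R z = (1 / (L + 1)) *\<^sub>R (L *\<^sub>R 1 - h * h)"
  proof -
    have "(L + 1) *\<^sub>R (1 - (1 / (L + 1)) *\<^sub>R z) = L *\<^sub>R 1 - h * h"
      using L by (simp add: scaleR_diff_right zh scaleR_left_distrib)
    then have "(1 / (L + 1)) *\<^sub>R ((L + 1) *\<^sub>R (1 - (1 / (L + 1)) *\<^sub>R z)) = (1 / (L + 1)) *\<^sub>R (L *\<^sub>R 1 - h * h)"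
      by simp
    then show ?thesis using L by simp
  qed
  ultimately have "norm (1 - (1 / (L + 1)) *\<^sub>R z) \<le> (1 / (L + 1)) * L"
    using L by (simp add: divide_right_mono)
  also have "\<dots> < 1" using L by simp
  finally obtain d where d: "(1 / (L + 1)) *\<^sub>R z * d = 1" "d * ((1 / (L + 1)) *\<^sub>R z) = 1"
    using neumann_inverse[of "1 - (1 / (L + 1)) *\<^sub>R z"] by auto
  define w where "w = (1 / (L + 1)) *\<^sub>R d"
  have w: "z * w = 1" "w * z = 1" using d by (simp_all add: w_def)
  have wc: "w * x = x * w" if "x * z = z * x" for x
  proof -
    have "w * x = w * (x * z) * w" by (simp add: mult.assoc w)
    then show ?thesis unfolding that by (simp add: w flip: mult.assoc)
  qed
  have sw: "star w = w"
  proof -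
    have "star w * z = 1" using arg_cong[OF w(1), of star] by (simp add: star_simps sz)
    then have "star w * z * w = w" by simp
    then show ?thesis by (simp add: mult.assoc w)
  qed
  have wE: "w * E = E * w" "w * star E = star E * w"
    by (intro wc; simp add: Ez sEz)+
  define R where "R = E * star E * w"
  have sR: "star R = R"
  proof -
    have "star R = w * E * star E" by (simp add: R_def star_simps sw mult.assoc)
    also have "\<dots> = R" unfolding wE(1) R_def by (simp add: mult.assoc wE(2))
    finally show ?thesis .
  qed
  have ER: "E * R = R" by (simp add: R_def EE flip: mult.assoc)
  have RE: "R * E = E"
  proof -
    have "R * E = (E * star E * E) * w" by (simp add: R_def mult.assoc wE(1))
    also have "\<dots> = E * (z * w)" unfolding Ez(1)[symmetric] by (simp add: mult.assoc)
    finally show ?thesis by (simp add: w)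
  qed
  have "R * R = R * E * (star E * w)" unfolding R_def by (simp add: mult.assoc)
  then have RR: "R * R = R" unfolding RE by (simp add: R_def mult.assoc)
  have Ec: "E * c = c" by (simp add: E_def mult.assoc y' assms)
  have "R * c = R * E * c" by (simp add: mult.assoc Ec)
  then have Rc: "R * c = c" by (simp add: RE Ec)
  have "corner_iso c (y' * R) r R"
    unfolding corner_iso_def using y' assms Rc RR ER
    by (simp add: mult.assoc E_def) (simp add: y'(2) flip: mult.assoc)
  moreover have "is_proj star R" by (simp add: is_proj_def sR RR)
  ultimately show ?thesis using that by blast
qed

text \<open>Polar decomposition of \<open>x\<close>: extend \<open>star x * x\<close> from the
  corner of \<open>q\<close> by \<open>1 - q\<close> to an invertible \<open>h\<close>, and multiply
  \<open>x\<close> by an inverse square root of the absolute value of \<open>h\<close>. The result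
  \<open>w\<close> satisfies \<open>star w * w = q * s\<close> with \<open>s\<close> the sign of
  \<open>h\<close>, and positivity of \<open>star w * w\<close> forces \<open>s\<close> to be 1 on
  \<open>q\<close>.\<close>

lemma corner_iso_imp_mvn_equiv:
  assumes "is_proj star p" "is_proj star q" "corner_iso x y q p"
  shows "mvn_equiv star p q"
proof -
  have sp: "star p = p" "p * p = p" and sq: "star q = q" "q * q = q"
    using assms by (auto simp: is_proj_def)
  have xy: "p * x = x" "x * q = x" "q * y = y" "y * p = y" "y * x = q" "x * y = p"
    using assms(3) by (auto simp: corner_iso_def)
  have sxy: "star x * p = star x" "q * star x = star x" "star y * q = star y" "p * star y = star y"
     "star x * star y = q" "star y * star x = p"
    using xy[THEN arg_cong[of _ _ star]] by (simp_all add: star_mult sp sq)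
  define h where "h = star x * x + (1 - q)"
  define k where "k = y * star y + (1 - q)"
  have sh: "star h = h" by (simp add: h_def star_simps sq)
  have "star x * x * (y * star y) = star x * (x * y) * star y" by (simp add: mult.assoc)
  then have hk: "h * k = 1"
    by (simp add: h_def k_def xy sxy distrib_left distrib_right left_diff_distrib right_diff_distrib
        mult.assoc sq mult_eq_assoc[OF xy(3)])
  have "y * star y * (star x * x) = y * (star y * star x) * x" by (simp add: mult.assoc)
  then have kh: "k * h = 1"
    by (simp add: h_def k_def xy sxy distrib_left distrib_right left_diff_distrib right_diff_distrib
        mult.assoc sq mult_eq_assoc[OF sxy(2)])
  obtain c where c: "c > 0" "norm (1 - c *\<^sub>R (h * h)) < 1"
    using square_near_one[OF sh hk kh] by blast
  have sc: "star (c *\<^sub>R (h * h)) = c *\<^sub>R (h * h)" by (simp add: star_simps sh)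
  \<comment> \<open>\<open>m\<close> stands for \<open>sqrt c\<close> times the absolute value of
    \<open>h\<close>, and \<open>n\<close> for the square root of \<open>m\<close>; so with
    \<open>d\<close> the inverse of \<open>n\<close>, the element
    \<open>sqrt c *\<^sub>R (d * h * d)\<close> is the sign of \<open>h\<close>.\<close>
  obtain m where m: "star m = m" "m * m = c *\<^sub>R (h * h)" "norm (1 - m) < 1"
    and mc: "\<And>b. b * (c *\<^sub>R (h * h)) = (c *\<^sub>R (h * h)) * b \<Longrightarrow> b * m = m * b"
    using sqrt_exists[OF sc c(2)] by metis
  obtain n where n: "star n = n" "n * n = m" "norm (1 - n) < 1"
    and nc: "\<And>b. b * m = m * b \<Longrightarrow> b * n = n * b"
    using sqrt_exists[OF m(1,3)] by blast
  obtain d where d: "n * d = 1" "d * n = 1"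
    using neumann_inverse[OF n(3)] by auto
  have sd: "star d = d"
  proof -
    have "star d * n = 1" using arg_cong[OF d(1), of star] by (simp add: star_simps n(1))
    then have "star d * n * d = d" by simp
    then show ?thesis by (simp add: mult.assoc d)
  qed
  have dc: "b * d = d * b" if "b * h = h * b" for b
  proof -
    have "b * (h * h) = (h * h) * b" using that by (metis mult.assoc)
    then have "b * n = n * b" by (intro nc mc) simp
    then have "d * (b * n) * d = d * (n * b) * d" by simp
    then show ?thesis by (simp add: mult.assoc d) (simp add: d flip: mult.assoc)
  qed
  have hd: "h * d = d * h" by (rule dc) simp
  define s where "s = sqrt c *\<^sub>R (d * h * d)"
  have ss: "star s = s" by (simp add: s_def star_simps sd sh mult.assoc)
  have "d * h * d * (d * h * d) = d * d * (h * h) * (d * d)" by (metis hd mult.assoc)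
  then have "s * s = d * d * (c *\<^sub>R (h * h)) * (d * d)" using c(1) by (simp add: s_def)
  also have "\<dots> = d * (d * n) * (n * n) * ((n * d) * d)" by (simp add: n(2) flip: m(2)) (simp add: mult.assoc flip: n(2))
  also have "\<dots> = 1" by (simp add: d mult.assoc mult_eq_assoc[OF d(1)] mult_eq_assoc[OF d(2)])
  finally have s2: "s * s = 1" .
  have qh: "q * h = star x * x" "h * q = star x * x"
    by (simp_all add: h_def distrib_left distrib_right left_diff_distrib right_diff_distrib sq
        xy sxy mult.assoc mult_eq_assoc[OF sxy(2)])
  have qd: "q * d = d * q" by (rule dc) (simp add: qh)
  have qs: "q * s = sqrt c *\<^sub>R (d * (star x * x) * d)" "s * q = q * s"
  proof -
    have "q * (d * h * d) = d * (q * h) * d" by (metis qd mult.assoc)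
    then show 1: "q * s = sqrt c *\<^sub>R (d * (star x * x) * d)" by (simp add: s_def qh)
    have "d * h * d * q = d * (h * q) * d" by (metis qd mult.assoc)
    then show "s * q = q * s" unfolding 1 by (simp add: s_def qh)
  qed
  \<comment> \<open>The part of \<open>q\<close> on which the symmetry \<open>s\<close> is -1. There
    \<open>star (w * E) * (w * E) = - E\<close>, which \<open>star_mult_eq_neg_proj\<close> permits
    only for \<open>E = 0\<close>.\<close>
  define E where "E = (1/2) *\<^sub>R (1 - s) * q"
  have sE: "star E = E" by (simp add: E_def star_simps ss sq left_diff_distrib right_diff_distrib qs(2))
  have sEm: "s * E = - E"
    by (simp add: E_def right_diff_distrib left_diff_distrib s2 mult_eq_assoc[OF s2] flip: scaleR_minus_right)
  have qE: "q * E = E" "E * q = E"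
    by (simp_all add: E_def right_diff_distrib left_diff_distrib sq mult.assoc qs(2) mult_eq_assoc[OF sq(2)])
  have "E * E = (1/2) *\<^sub>R ((1 - s) * (q * E))"
    by (subst (1) E_def) (simp only: mult.assoc mult_scaleR_left)
  also have "(1 - s) * (q * E) = 2 *\<^sub>R E"
    by (simp add: qE sEm left_diff_distrib scaleR_2)
  also have "(1/2) *\<^sub>R (2 *\<^sub>R E) = E" by simp
  finally have EE: "E * E = E" .
  define \<rho> where "\<rho> = sqrt (sqrt c)"
  have \<rho>: "\<rho> > 0" "\<rho> * \<rho> = sqrt c" using c by (auto simp: \<rho>_def)
  define w where "w = \<rho> *\<^sub>R (x * d)"
  have ww: "star w * w = q * s"
    by (simp add: w_def star_simps sd \<rho> qs mult.assoc)
  have "star (w * E) * (w * E) = E * (star w * w) * E" by (simp add: star_simps sE mult.assoc)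
  also have "\<dots> = (E * q) * (s * E)" by (simp add: ww mult.assoc)
  also have "\<dots> = - E" by (simp add: sEm qE EE)
  finally have "E = 0"
    by (rule star_mult_eq_neg_proj) (simp add: is_proj_def sE EE)
  then have "q = s * q" by (simp add: E_def left_diff_distrib)
  then have wq: "star w * w = q" by (simp add: ww qs(2))
  have w: "w * q = w" "star x * p = star x"
    using qd by (simp_all add: w_def mult.assoc xy sxy flip: qd) (simp add: xy flip: mult.assoc)
  have "w * (n * y) = \<rho> *\<^sub>R p" by (simp add: w_def mult.assoc mult_eq_assoc[OF d(2)] xy)
  then have p: "p = (1/\<rho>) *\<^sub>R (w * (n * y))" using \<rho> by simp
  have "w * star w * p = (1/\<rho>) *\<^sub>R (w * (star w * w) * (n * y))"
    by (subst p) (simp add: mult.assoc)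
  also have "\<dots> = p" by (simp add: wq w flip: p)
  finally have "w * star w * p = p" .
  moreover have "star w * p = star w" by (simp add: w_def star_simps mult.assoc sxy)
  ultimately have "w * star w = p" by (simp add: mult.assoc)
  with wq show ?thesis unfolding mvn_equiv_def by blast
qed

section \<open>Projections and Murray-von Neumann equivalence\<close>

lemma is_projD: "is_proj star p \<Longrightarrow> star p = p" "is_proj star p \<Longrightarrow> p * p = p"
  by (auto simp: is_proj_def)

lemma is_proj_one_minus: "is_proj star p \<Longrightarrow> is_proj star (1 - p)"
  by (simp add: is_proj_def star_simps algebra_simps)

lemma is_proj_swap: "is_proj star p \<Longrightarrow> is_proj star q \<Longrightarrow> p * q = r \<Longrightarrow> q * p = star r"
  by (auto simp: is_proj_def star_mult)

lemma norm_proj_le_1: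
  assumes "is_proj star p"
  shows "norm p \<le> 1"
proof -
  have "norm p * norm p = norm p"
    using norm_star_mult[of p] is_projD[OF assms] by (simp add: power2_eq_square)
  then show ?thesis by auto
qed

text \<open>The C*-identity turns \<open>(1 - q) * (v * star v) * (1 - q) = 0\<close> into
  \<open>v - q * v = 0\<close>.\<close>

lemma range_proj_mult:
  assumes "v * star v = q" "is_proj star q"
  shows "q * v = v"
proof -
  note q = is_projD[OF assms(2)]
  have "star (star (v - q * v)) * star (v - q * v) = (1 - q) * (v * star v) * (1 - q)"
    by (simp add: star_simps q algebra_simps)
  also have "\<dots> = 0" by (simp add: assms(1) q algebra_simps)
  finally have "star (v - q * v) = 0" by (rule star_mult_eq_0)
  then have "star (star (v - q * v)) = 0" by simp
  then show ?thesis by simp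
qed

lemma is_proj_star_mult:
  assumes "v * star v = q" "is_proj star q"
  shows "is_proj star (star v * v)"
proof -
  have "star v * v * (star v * v) = star v * (v * star v * v)" by (simp add: mult.assoc)
  then show ?thesis
    using range_proj_mult[OF assms] by (simp add: is_proj_def star_mult assms(1))
qed

lemma mvn_equiv_refl: "is_proj star p \<Longrightarrow> mvn_equiv star p p"
  by (auto simp: mvn_equiv_def is_proj_def intro!: exI[of _ p])

lemma mvn_equiv_sym: "mvn_equiv star p q \<Longrightarrow> mvn_equiv star q p"
  unfolding mvn_equiv_def by (metis star_star)

lemma mvn_equiv_trans:
  assumes "is_proj star p" "is_proj star r" "mvn_equiv star p q" "mvn_equiv star q r"
  shows "mvn_equiv star p r"
proof -
  obtain v w where v: "v * star v = p" "star v * v = q" and w: "w * star w = q" "star w * w = r"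
    using assms(3,4) by (auto simp: mvn_equiv_def)
  have "v * w * star (v * w) = v * (w * star w) * star v" by (simp add: star_mult mult.assoc)
  also have "\<dots> = (v * star v) * (v * star v)" by (simp add: w(1) mult.assoc flip: v(2))
  finally have 1: "v * w * star (v * w) = p" using is_projD[OF assms(1)] by (simp add: v)
  have "star (v * w) * (v * w) = star w * (star v * v) * w" by (simp add: star_mult mult.assoc)
  also have "\<dots> = (star w * w) * (star w * w)" by (simp add: v(2) mult.assoc flip: w(1))
  finally have "star (v * w) * (v * w) = r" using is_projD[OF assms(2)] by (simp add: w)
  with 1 show ?thesis unfolding mvn_equiv_def by blast
qed

text \<open>The sum of the two partial isometries works, because orthogonality of their initial and
  of their final projections kills the mixed products.\<close>

lemma mvn_equiv_add:
  assumes "is_proj star p" "is_proj star q" "is_proj star p'" "is_proj star q'"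
    "p * q = 0" "p' * q' = 0" "mvn_equiv star p p'" "mvn_equiv star q q'"
  shows "mvn_equiv star (p + q) (p' + q')"
proof -
  obtain v w where v: "v * star v = p" "star v * v = p'" and w: "w * star w = q" "star w * w = q'"
    using assms(7,8) by (auto simp: mvn_equiv_def)
  have pv: "p * v = v" "q * w = w" "p' * star v = star v" "q' * star w = star w"
    using range_proj_mult[of v p] range_proj_mult[of w q] range_proj_mult[of "star v" p']
      range_proj_mult[of "star w" q'] v w assms(1-4) by simp_all
  have "v * star w = star (p' * star v) * (q' * star w)" by (simp add: pv)
  also have "\<dots> = v * (p' * q') * star w" by (simp add: star_mult is_projD[OF assms(3)] mult.assoc)
  finally have vw: "v * star w = 0" by (simp add: assms)
  have "star v * w = star (p * v) * (q * w)" by (simp add: pv)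
  also have "\<dots> = star v * (p * q) * w" by (simp add: star_mult is_projD[OF assms(1)] mult.assoc)
  finally have vw': "star v * w = 0" by (simp add: assms)
  have wv: "w * star v = 0" "star w * v = 0"
    using arg_cong[OF vw, of star] arg_cong[OF vw', of star] by (simp_all add: star_mult)
  have "(v + w) * star (v + w) = p + q" "star (v + w) * (v + w) = p' + q'"
    by (simp_all add: star_add distrib_left distrib_right v w vw vw' wv)
  then show ?thesis unfolding mvn_equiv_def by blast
qed

lemma is_proj_add:
  assumes "is_proj star p" "is_proj star q" "p * q = 0"
  shows "is_proj star (p + q)"
  using assms is_proj_swap[OF assms] by (simp add: is_proj_def star_add distrib_left distrib_right)

lemma is_proj_diff:
  assumes "is_proj star p" "is_proj star q" "p * q = p"
  shows "is_proj star (q - p)"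
  using assms is_proj_swap[OF assms] by (simp add: is_proj_def star_diff left_diff_distrib right_diff_distrib)

end

section \<open>The semigroup of projection classes\<close>

locale finite_type = cstar star for star :: "'a::{real_normed_algebra_1,banach} \<Rightarrow> 'a" +
  fixes F :: "'a set"
  assumes finite_type: "finite_type_alg star F"
begin

abbreviation "\<P> \<equiv> projF star F"
abbreviation "cls \<equiv> pclass star F"
abbreviation "\<S> \<equiv> psemi star F"
abbreviation add_class (infixl "\<oplus>" 65) where "X \<oplus> Y \<equiv> padd star F X Y"

lemma F_zero: "0 \<in> F"
  and F_add: "x \<in> F \<Longrightarrow> y \<in> F \<Longrightarrow> x + y \<in> F"
  and F_scaleR: "x \<in> F \<Longrightarrow> r *\<^sub>R x \<in> F"
  and F_mult_left: "x \<in> F \<Longrightarrow> a * x \<in> F"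
  and F_mult_right: "x \<in> F \<Longrightarrow> x * a \<in> F"
  using finite_type unfolding finite_type_alg_def sa_ideal_def by blast+

lemma F_minus: "x \<in> F \<Longrightarrow> - x \<in> F"
  using F_scaleR[of x "-1"] by simp

lemma F_diff: "x \<in> F \<Longrightarrow> y \<in> F \<Longrightarrow> x - y \<in> F"
  using F_add[of x "- y"] F_minus[of y] by simp

lemma projF_iff: "p \<in> \<P> \<longleftrightarrow> p \<in> F \<and> is_proj star p"
  by (simp add: projF_def)

text \<open>Two elements are served at once so that two sets of index data, or index data and the
  error of a parametrix, can be handled over a common projection.\<close>

lemma approx_unit:
  assumes "f \<in> F" "g \<in> F" "\<delta> > 0" "\<epsilon> > 0"
  obtains p where "p \<in> \<P>" "norm (f * (1 - p)) < \<delta>" "norm (g * (1 - p)) < \<epsilon>"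
proof -
  obtain U where U: "U \<noteq> bot" "eventually (\<lambda>p. p \<in> F \<and> is_proj star p) U"
    "\<And>f. f \<in> F \<Longrightarrow> ((\<lambda>p. norm (f - f * p)) \<longlongrightarrow> 0) U"
    using finite_type unfolding finite_type_alg_def has_proj_approx_unit_def by blast
  have "eventually (\<lambda>p. (p \<in> F \<and> is_proj star p) \<and> norm (f - f * p) < \<delta> \<and> norm (g - g * p) < \<epsilon>) U"
    using order_tendstoD(2)[OF U(3)[OF assms(1)] assms(3)] order_tendstoD(2)[OF U(3)[OF assms(2)] assms(4)]
    by (intro eventually_conj U(2))
  then obtain p where "p \<in> F" "is_proj star p" "norm (f - f * p) < \<delta>" "norm (g - g * p) < \<epsilon>"
    using eventually_happens' U(1) by blast
  with that show ?thesis by (simp add: projF_iff right_diff_distrib)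
qed

lemma pclass_eq_iff:
  assumes "p \<in> \<P>" "q \<in> \<P>"
  shows "cls p = cls q \<longleftrightarrow> mvn_equiv star p q"
proof
  assume "cls p = cls q"
  moreover have "q \<in> cls q" using assms by (simp add: pclass_def projF_iff mvn_equiv_refl)
  ultimately show "mvn_equiv star p q" by (auto simp: pclass_def)
next
  assume "mvn_equiv star p q"
  then show "cls p = cls q"
    using assms mvn_equiv_sym mvn_equiv_trans unfolding pclass_def projF_iff by blast
qed

lemma projF_add: "p \<in> \<P> \<Longrightarrow> q \<in> \<P> \<Longrightarrow> p * q = 0 \<Longrightarrow> p + q \<in> \<P>"
  by (simp add: projF_iff F_add is_proj_add)

lemma projF_star_mult:
  assumes "q \<in> \<P>" "v * star v = q"
  shows "star v * v \<in> \<P>"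
proof -
  have "star v * v = star v * (q * v)"
    using range_proj_mult[OF assms(2)] assms(1) by (simp add: projF_iff)
  then have "star v * v \<in> F" using assms(1) F_mult_left F_mult_right by (simp add: projF_iff)
  then show ?thesis using is_proj_star_mult[OF assms(2)] assms(1) by (simp add: projF_iff)
qed

lemma padd_pclass:
  assumes p: "p \<in> \<P>" and q: "q \<in> \<P>" and "p * q = 0"
  shows "cls p \<oplus> cls q = cls (p + q)"
  unfolding padd_def
proof (rule some_equality)
  have "q * p = 0" using assms is_proj_swap[of p q 0] by (simp add: projF_iff)
  moreover have "p \<in> cls p" "q \<in> cls q"
    using p q by (simp_all add: pclass_def projF_iff mvn_equiv_refl)
  ultimately show "\<exists>p' q' v. p' \<in> cls p \<and> q' \<in> cls q \<and> v * star v = q' \<and> star v * v * p' = 0 \<and>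
      cls (p + q) = cls (p' + star v * v)"
    using is_projD[of q] q by (intro exI[of _ p] exI[of _ q]) (simp add: projF_iff)
next
  fix Z
  assume "\<exists>p' q' v. p' \<in> cls p \<and> q' \<in> cls q \<and> v * star v = q' \<and> star v * v * p' = 0 \<and>
      Z = cls (p' + star v * v)"
  then obtain p' q' v where *: "p' \<in> cls p" "q' \<in> cls q" "v * star v = q'" "star v * v * p' = 0"
    and Z: "Z = cls (p' + star v * v)" by blast
  define r where "r = star v * v"
  have P: "p' \<in> \<P>" "q' \<in> \<P>" and e: "mvn_equiv star p p'" "mvn_equiv star q q'"
    using *(1,2) by (auto simp: pclass_def)
  have r: "r \<in> \<P>" unfolding r_def by (rule projF_star_mult[OF P(2) *(3)])
  have pr: "p' * r = 0" using is_proj_swap[of r p' 0] *(4) r P by (simp add: r_def projF_iff)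
  have "mvn_equiv star q' r" unfolding mvn_equiv_def r_def using *(3) by blast
  then have "mvn_equiv star q r" using mvn_equiv_trans e(2) q r by (auto simp: projF_iff)
  then have "mvn_equiv star (p + q) (p' + r)"
    using mvn_equiv_add e(1) assms P r pr by (simp add: projF_iff)
  then show "Z = cls (p + q)"
    using pclass_eq_iff[of "p + q" "p' + r"] projF_add assms P r pr by (simp add: Z r_def)
qed

text \<open>Reduces the laws of the semigroup to sums of orthogonal projections. The representative
  is \<open>star v * v\<close>, with \<open>v\<close> from the third axiom of a finite type
  algebra.\<close>

lemma psemiE:
  assumes "X \<in> \<S>" "p \<in> \<P>"
  obtains q where "q \<in> \<P>" "X = cls q" "p * q = 0"
proof -
  obtain q where q: "q \<in> \<P>" "X = cls q" using assms(1) by (auto simp: psemi_def)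
  obtain v where v: "v * star v = q" "star v * v * p = 0"
    using finite_type assms(2) q unfolding finite_type_alg_def projF_iff by blast
  have r: "star v * v \<in> \<P>" by (rule projF_star_mult[OF q(1) v(1)])
  have "mvn_equiv star q (star v * v)" using v(1) by (auto simp: mvn_equiv_def)
  then have "X = cls (star v * v)" using pclass_eq_iff q r by simp
  moreover have "p * (star v * v) = 0"
    using is_proj_swap[of "star v * v" p 0] v(2) r assms(2) by (simp add: projF_iff)
  ultimately show ?thesis using that r by blast
qed

lemma pclass_in_psemi [simp]: "p \<in> \<P> \<Longrightarrow> cls p \<in> \<S>"
  by (simp add: psemi_def)

lemma projF_zero: "0 \<in> \<P>"
  by (simp add: projF_iff F_zero is_proj_def)

lemma padd_closed [simp]:
  assumes "X \<in> \<S>" "Y \<in> \<S>"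
  shows "X \<oplus> Y \<in> \<S>"
proof -
  obtain p where p: "p \<in> \<P>" "X = cls p" using psemiE[OF assms(1) projF_zero] .
  obtain q where q: "q \<in> \<P>" "Y = cls q" "p * q = 0" using psemiE[OF assms(2) p(1)] .
  show ?thesis by (simp add: p q padd_pclass projF_add)
qed

lemma padd_commute:
  assumes "X \<in> \<S>" "Y \<in> \<S>"
  shows "X \<oplus> Y = Y \<oplus> X"
proof -
  obtain p where p: "p \<in> \<P>" "X = cls p" using psemiE[OF assms(1) projF_zero] .
  obtain q where q: "q \<in> \<P>" "Y = cls q" "p * q = 0" using psemiE[OF assms(2) p(1)] .
  have "q * p = 0" using is_proj_swap[of p q 0] p q by (simp add: projF_iff)
  then show ?thesis by (simp add: p q padd_pclass add.commute)
qed

lemma padd_assoc: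
  assumes "X \<in> \<S>" "Y \<in> \<S>" "Z \<in> \<S>"
  shows "X \<oplus> Y \<oplus> Z = X \<oplus> (Y \<oplus> Z)"
proof -
  obtain p where p: "p \<in> \<P>" "X = cls p" using psemiE[OF assms(1) projF_zero] .
  obtain q where q: "q \<in> \<P>" "Y = cls q" "p * q = 0" using psemiE[OF assms(2) p(1)] .
  have pq: "p + q \<in> \<P>" using p q by (simp add: projF_add)
  obtain r where r: "r \<in> \<P>" "Z = cls r" "(p + q) * r = 0" using psemiE[OF assms(3) pq] .
  have "p * r = p * ((p + q) * r)"
    using is_projD(2)[of p] p(1) q(3)
    by (simp add: projF_iff distrib_left flip: mult.assoc)
  then have pr: "p * r = 0" using r by simp
  then have qr: "q * r = 0" using r(3) by (simp add: distrib_right)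
  have "p * (q + r) = 0" by (simp add: distrib_left q pr)
  then show ?thesis
    by (simp add: p q r pq pr qr padd_pclass projF_add add.assoc)
qed

lemma padd_left_commute:
  assumes "X \<in> \<S>" "Y \<in> \<S>" "Z \<in> \<S>"
  shows "X \<oplus> (Y \<oplus> Z) = Y \<oplus> (X \<oplus> Z)"
  using assms by (metis padd_assoc padd_commute)

lemmas padd_ac = padd_assoc padd_commute padd_left_commute

section \<open>The Grothendieck group\<close>

text \<open>Transitivity of the Grothendieck relation: adding the two equations leaves
  \<open>X \<oplus> Y\<close> over on both sides, and together with \<open>W\<close> and
  \<open>Z\<close> it forms the new stabilising summand.\<close>

lemma kclass_subset:
  assumes S: "X \<in> \<S>" "Y \<in> \<S>" "X' \<in> \<S>" "Y' \<in> \<S>" "W \<in> \<S>"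
    and eq: "X \<oplus> Y' \<oplus> W = X' \<oplus> Y \<oplus> W"
  shows "kclass star F X Y \<subseteq> kclass star F X' Y'"
proof (clarsimp simp: kclass_def)
  fix A B Z
  assume A: "A \<in> \<S>" "B \<in> \<S>" "Z \<in> \<S>" and AB: "X \<oplus> B \<oplus> Z = A \<oplus> Y \<oplus> Z"
  have "X' \<oplus> B \<oplus> (X \<oplus> Y \<oplus> W \<oplus> Z) = (X' \<oplus> Y \<oplus> W) \<oplus> (X \<oplus> B \<oplus> Z)"
    using S A by (simp add: padd_ac)
  also have "\<dots> = (X \<oplus> Y' \<oplus> W) \<oplus> (A \<oplus> Y \<oplus> Z)" unfolding eq AB ..
  also have "\<dots> = A \<oplus> Y' \<oplus> (X \<oplus> Y \<oplus> W \<oplus> Z)"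
    using S A by (simp add: padd_ac)
  finally show "\<exists>Z\<in>\<S>. X' \<oplus> B \<oplus> Z = A \<oplus> Y' \<oplus> Z"
    using S A by (intro bexI[of _ "X \<oplus> Y \<oplus> W \<oplus> Z"]) auto
qed

lemma kclass_eqI:
  assumes "X \<in> \<S>" "Y \<in> \<S>" "X' \<in> \<S>" "Y' \<in> \<S>" "W \<in> \<S>"
    "X \<oplus> Y' \<oplus> W = X' \<oplus> Y \<oplus> W"
  shows "kclass star F X Y = kclass star F X' Y'"
  using kclass_subset[OF assms] kclass_subset[OF assms(3,4,1,2,5) assms(6)[symmetric]] by blast

lemma kclass_eqI':
  assumes "X \<in> \<S>" "Y \<in> \<S>" "X' \<in> \<S>" "Y' \<in> \<S>" "X \<oplus> Y' = X' \<oplus> Y"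
  shows "kclass star F X Y = kclass star F X' Y'"
  using kclass_eqI[OF assms(1-4,1)] assms(5) by simp

lemma kadd_kclass:
  assumes S: "X \<in> \<S>" "Y \<in> \<S>" "X' \<in> \<S>" "Y' \<in> \<S>"
  shows "kadd star F (kclass star F X Y) (kclass star F X' Y') = kclass star F (X \<oplus> X') (Y \<oplus> Y')"
  unfolding kadd_def
proof (rule some_equality)
  have "(X, Y) \<in> kclass star F X Y" "(X', Y') \<in> kclass star F X' Y'"
    using S by (auto simp: kclass_def)
  then show "\<exists>A B A' B'. (A, B) \<in> kclass star F X Y \<and> (A', B') \<in> kclass star F X' Y' \<and>
     kclass star F (X \<oplus> X') (Y \<oplus> Y') = kclass star F (A \<oplus> A') (B \<oplus> B')" by blast
next
  fix M
  assume "\<exists>A B A' B'. (A, B) \<in> kclass star F X Y \<and> (A', B') \<in> kclass star F X' Y' \<and>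
     M = kclass star F (A \<oplus> A') (B \<oplus> B')"
  then obtain A B A' B' Z Z' where M: "M = kclass star F (A \<oplus> A') (B \<oplus> B')"
    and A: "A \<in> \<S>" "B \<in> \<S>" "A' \<in> \<S>" "B' \<in> \<S>" "Z \<in> \<S>" "Z' \<in> \<S>"
    and eq: "X \<oplus> B \<oplus> Z = A \<oplus> Y \<oplus> Z" "X' \<oplus> B' \<oplus> Z' = A' \<oplus> Y' \<oplus> Z'"
    by (auto simp: kclass_def)
  have "X \<oplus> X' \<oplus> (B \<oplus> B') \<oplus> (Z \<oplus> Z') = (X \<oplus> B \<oplus> Z) \<oplus> (X' \<oplus> B' \<oplus> Z')"
    using S A by (simp add: padd_ac)
  also have "\<dots> = A \<oplus> A' \<oplus> (Y \<oplus> Y') \<oplus> (Z \<oplus> Z')"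
    unfolding eq using S A by (simp add: padd_ac)
  finally show "M = kclass star F (X \<oplus> X') (Y \<oplus> Y')"
    unfolding M using S A by (intro kclass_eqI[symmetric, where W = "Z \<oplus> Z'"]) auto
qed

section \<open>Invertibility up to projections and range projections\<close>

lemma inv_upto_iff:
  assumes "is_proj star p" "is_proj star q"
  shows "inv_upto a p q \<longleftrightarrow> (\<exists>b. corner_iso ((1 - q) * (a * (1 - p))) b (1 - p) (1 - q))"
proof -
  note pq = is_projD(2)[OF is_proj_one_minus[OF assms(1)]] is_projD(2)[OF is_proj_one_minus[OF assms(2)]]
  have "(b = (1 - p) * b * (1 - q) \<and> (1 - q) * a * (1 - p) * b = 1 - q \<and> b * (1 - q) * a * (1 - p) = 1 - p)
     \<longleftrightarrow> corner_iso ((1 - q) * (a * (1 - p))) b (1 - p) (1 - q)" for b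
    unfolding corner_iso_def mult.assoc pq mult_eq_assoc[OF pq(1)] mult_eq_assoc[OF pq(2)]
    by (metis mult.assoc pq)
  then show ?thesis unfolding inv_upto_def by blast
qed

text \<open>Here \<open>1 - q\<close> is the range projection of \<open>a * (1 - p)\<close>, whereas \<open>inv_upto a p q\<close> only asks
  for the compression \<open>(1 - q) * a * (1 - p)\<close> to be invertible.\<close>

definition adapted :: "'a \<Rightarrow> 'a \<Rightarrow> 'a \<Rightarrow> bool" where
  "adapted a p q \<longleftrightarrow> (\<exists>S. corner_iso (a * (1 - p)) S (1 - p) (1 - q))"

lemma adapted_imp_inv_upto:
  assumes "is_proj star p" "is_proj star q" "adapted a p q"
  shows "inv_upto a p q"
proof -
  obtain S where S: "corner_iso (a * (1 - p)) S (1 - p) (1 - q)"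
    using assms(3) by (auto simp: adapted_def)
  then have "(1 - q) * (a * (1 - p)) = a * (1 - p)" by (simp add: corner_iso_def)
  with S show ?thesis by (auto simp: inv_upto_iff[OF assms(1,2)])
qed

text \<open>A \<open>(p, q)\<close>-inverse inverts \<open>a\<close> modulo the ideal: the errors
  equal \<open>(b * a - 1) * p\<close> and \<open>q * (a * b - 1)\<close>. The last conclusion feeds
  \<open>adapted_exists\<close> at \<open>p\<close> itself.\<close>

lemma inv_upto_parametrix:
  assumes "p \<in> \<P>" "q \<in> \<P>" "inv_upto a p q"
  obtains b where "b * a - 1 \<in> F" "a * b - 1 \<in> F" "(b * a - 1) * (1 - p) = 0"
proof -
  obtain b where b: "corner_iso ((1 - q) * (a * (1 - p))) b (1 - p) (1 - q)"
    using assms by (auto simp: inv_upto_iff projF_iff)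
  then have b: "b * ((1 - q) * (a * (1 - p))) = 1 - p" "(1 - q) * (a * (1 - p)) * b = 1 - q"
    "b * (1 - q) = b" "(1 - p) * b = b" by (auto simp: corner_iso_def)
  have "b * (a * (1 - p)) = b * (1 - q) * (a * (1 - p))" by (simp add: b(3))
  then have "b * a * (1 - p) = 1 - p" using b(1) by (simp add: mult.assoc)
  then have 1: "(b * a - 1) * (1 - p) = 0" by (simp add: left_diff_distrib)
  then have 2: "b * a - 1 = (b * a - 1) * p" by (simp add: right_diff_distrib)
  have "(1 - q) * (a * ((1 - p) * b)) = 1 - q" using b(2) by (simp add: mult.assoc)
  then have "(1 - q) * (a * b) = 1 - q" by (simp add: b(4))
  then have "(1 - q) * (a * b - 1) = 0" by (simp add: right_diff_distrib)
  then have 3: "a * b - 1 = q * (a * b - 1)" by (simp add: left_diff_distrib)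
  have "b * a - 1 \<in> F" "a * b - 1 \<in> F"
    using F_mult_left F_mult_right assms(1,2) by (subst 2 3, simp add: projF_iff)+
  with 1 show ?thesis by (intro that)
qed

text \<open>If the error \<open>g\<close> of the left inverse \<open>b\<close> is small on
  \<open>1 - p\<close>, then \<open>1 + g\<close> has an inverse \<open>d\<close>, and
  \<open>(1 - p) * d * b\<close> inverts \<open>a * (1 - p)\<close> exactly from the left; so
  \<open>range_projection\<close> applies.\<close>

lemma adapted_exists:
  assumes "is_proj star p" "norm ((b * a - 1) * (1 - p)) < 1"
  obtains q where "is_proj star q" "adapted a p q"
proof -
  note p = is_projD(2)[OF is_proj_one_minus[OF assms(1)]]
  define g where "g = (b * a - 1) * (1 - p)"
  have "norm (- g) < 1" using assms(2) by (simp add: g_def)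
  then obtain d where d: "d * (1 - - g) = 1" using neumann_inverse by metis
  have "b * (a * (1 - p)) = (1 - - g) * (1 - p)"
    by (simp add: g_def distrib_right mult.assoc p) (simp add: left_diff_distrib mult.assoc)
  then have "(1 - p) * d * b * (a * (1 - p)) = (1 - p) * (d * (1 - - g)) * (1 - p)"
    by (simp add: mult.assoc)
  then have "(1 - p) * d * b * (a * (1 - p)) = 1 - p" unfolding d by (simp add: p)
  moreover have "a * (1 - p) * (1 - p) = a * (1 - p)" by (simp add: mult.assoc p)
  ultimately obtain R S where R: "is_proj star R" "corner_iso (a * (1 - p)) S (1 - p) R"
    by (rule range_projection)
  then have "adapted a p (1 - R)" by (auto simp: adapted_def)
  with is_proj_one_minus[OF R(1)] show ?thesis by (rule that)
qed

text \<open>Since \<open>q\<close> annihilates \<open>a * (1 - p)\<close>, the element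
  \<open>q * a = q * a * p\<close> lies in the ideal, and then so does
  \<open>q = q * a * b - q * (a * b - 1)\<close>.\<close>

lemma adapted_in_projF:
  assumes "p \<in> \<P>" "is_proj star q" "adapted a p q" "a * b - 1 \<in> F"
  shows "q \<in> \<P>"
proof -
  obtain S where "corner_iso (a * (1 - p)) S (1 - p) (1 - q)"
    using assms(3) by (auto simp: adapted_def)
  then have "(1 - q) * (a * (1 - p)) = a * (1 - p)" by (simp add: corner_iso_def)
  then have "q * a = q * a * p" by (simp add: left_diff_distrib right_diff_distrib mult.assoc)
  then have "q * a \<in> F" using F_mult_left assms(1) by (metis projF_iff)
  moreover have "q = (q * a) * b - q * (a * b - 1)" by (simp add: right_diff_distrib mult.assoc)
  ultimately have "q \<in> F" using F_diff F_mult_left F_mult_right assms(4) by metis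
  with assms(2) show ?thesis by (simp add: projF_iff)
qed

lemma inv_upto_adapted:
  assumes "p \<in> \<P>" "q \<in> \<P>" "inv_upto a p q"
  obtains q' where "q' \<in> \<P>" "adapted a p q'"
proof -
  obtain b where b: "a * b - 1 \<in> F" "(b * a - 1) * (1 - p) = 0"
    using inv_upto_parametrix[OF assms] by blast
  then have "norm ((b * a - 1) * (1 - p)) < 1" by simp
  then obtain q' where "is_proj star q'" "adapted a p q'"
    using adapted_exists assms(1) by (metis projF_iff)
  with that adapted_in_projF[OF assms(1) _ _ b(1)] show ?thesis by blast
qed

text \<open>By \<open>corner_iso_complement\<close> the projections themselves are similar, hence
  equivalent; and \<open>q\<close> factors through \<open>q'\<close>, which puts it into the
  ideal.\<close>

lemma pclass_eq_complement:
  assumes "is_proj star q" "q' \<in> \<P>" "corner_iso ((1 - q) * (1 - q')) z (1 - q') (1 - q)"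
  shows "q \<in> \<P>" "cls q = cls q'"
proof -
  have q': "is_proj star q'" "q' \<in> F" using assms(2) by (auto simp: projF_iff)
  have iso: "corner_iso (q' * q) (q * q' - q * z * q') q q'"
    using is_projD(2) assms(1) q'(1) by (intro corner_iso_complement assms(3)) auto
  then have "q = (q * q' - q * z * q') * (q' * q)" by (simp add: corner_iso_def)
  also have "\<dots> \<in> F" using q'(2) by (intro F_mult_left F_mult_right)
  finally show P: "q \<in> \<P>" using assms(1) by (simp add: projF_iff)
  show "cls q = cls q'"
    using corner_iso_imp_mvn_equiv[OF q'(1) assms(1) iso] pclass_eq_iff[OF P assms(2)] mvn_equiv_sym
    by blast
qed

text \<open>Going back from \<open>1 - q'\<close> to \<open>1 - p\<close> by \<open>S\<close> and
  forward to \<open>1 - q\<close> by the compression of \<open>a\<close> amounts to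
  \<open>(1 - q) * (1 - q')\<close>, the situation of \<open>pclass_eq_complement\<close>.\<close>

lemma pclass_eq_adapted:
  assumes "p \<in> \<P>" "q \<in> \<P>" "q' \<in> \<P>" "inv_upto a p q" "adapted a p q'"
  shows "cls q = cls q'"
proof -
  obtain b where b: "corner_iso ((1 - q) * (a * (1 - p))) b (1 - p) (1 - q)"
    using assms by (auto simp: inv_upto_iff projF_iff)
  obtain S where S: "corner_iso (a * (1 - p)) S (1 - p) (1 - q')"
    using assms(5) by (auto simp: adapted_def)
  have "corner_iso ((1 - q) * (a * (1 - p)) * S) (a * (1 - p) * b) (1 - q') (1 - q)"
    by (rule corner_iso_trans[OF corner_iso_sym[OF S] b])
  moreover have "a * (1 - p) * S = 1 - q'" using S by (simp add: corner_iso_def)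
  ultimately have "corner_iso ((1 - q) * (1 - q')) (a * (1 - p) * b) (1 - q') (1 - q)"
    by (simp add: mult.assoc)
  then show ?thesis using pclass_eq_complement assms(2,3) by (simp add: projF_iff)
qed

section \<open>Enlarging the projection and independence of the index\<close>

text \<open>Passing from \<open>p\<close> to \<open>e\<close> adds \<open>r = e - p\<close> to the
  first entry and \<open>t = q' - q\<close> to the second. The compression
  \<open>t * (a * r)\<close> is invertible from \<open>r\<close> to \<open>t\<close> with inverse
  \<open>r * S\<close>, so the two increments are equivalent.\<close>

lemma adapted_mono:
  assumes P: "p \<in> \<P>" "e \<in> \<P>" "q \<in> \<P>" "q' \<in> \<P>" and pe: "p * e = p"
    and ad: "adapted a p q" "adapted a e q'"
  shows "cls p \<oplus> cls q' = cls e \<oplus> cls q"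
proof -
  have pr: "is_proj star p" "is_proj star e" "is_proj star q" "is_proj star q'"
    using P by (auto simp: projF_iff)
  note idem = pr[THEN is_projD(2)]
  have ep: "e * p = p" using is_proj_swap[OF pr(1,2) pe] is_projD(1)[OF pr(1)] by simp
  obtain S where "corner_iso (a * (1 - p)) S (1 - p) (1 - q)" using ad by (auto simp: adapted_def)
  then have S: "(1 - q) * (a * (1 - p)) = a * (1 - p)" "(1 - p) * S = S" "S * (1 - q) = S"
    "S * (a * (1 - p)) = 1 - p" "a * (1 - p) * S = 1 - q"
    by (auto simp: corner_iso_def)
  obtain T where "corner_iso (a * (1 - e)) T (1 - e) (1 - q')" using ad by (auto simp: adapted_def)
  then have T: "(1 - q') * (a * (1 - e)) = a * (1 - e)" "a * (1 - e) * T = 1 - q'"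
    by (auto simp: corner_iso_def)
  define r where "r = e - p"
  define t where "t = q' - q"
  have r: "is_proj star r" "p * r = 0" "p + r = e" "r * (1 - e) = 0" "(1 - p) * r = r"
    using is_proj_diff[OF pr(1,2) pe]
    by (simp_all add: r_def right_diff_distrib left_diff_distrib idem pe ep)
  have ape: "a * (1 - p) * (1 - e) = a * (1 - e)"
    by (simp add: mult.assoc) (simp add: right_diff_distrib left_diff_distrib pe)
  \<comment> \<open>The range of \<open>a * (1 - e)\<close> lies in that of
    \<open>a * (1 - p)\<close>, which gives \<open>q \<le> q'\<close>.\<close>
  have "(1 - q) * (1 - q') = (1 - q) * (a * (1 - p)) * (1 - e) * T"
    unfolding T(2)[symmetric] ape[symmetric] by (simp add: mult.assoc)
  also have "\<dots> = 1 - q'" unfolding S(1) ape T(2) ..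
  finally have qq: "q * q' = q" by (simp add: left_diff_distrib right_diff_distrib)
  have t: "is_proj star t" "q * t = 0" "q + t = q'" "t * (1 - q) = t" "t * (1 - q') = 0"
    using is_proj_diff[OF pr(3,4) qq] is_proj_swap[OF pr(3,4) qq] is_projD(1)[OF pr(3)]
    by (simp_all add: t_def right_diff_distrib left_diff_distrib idem qq)
  have rt: "r \<in> \<P>" "t \<in> \<P>" using r(1) t(1) P by (simp_all add: r_def t_def projF_iff F_diff)
  have ar: "a * (1 - p) * r = a * r" by (simp add: mult.assoc r)
  \<comment> \<open>On \<open>1 - q'\<close>, the range of \<open>a * (1 - e)\<close>, the map
    \<open>S\<close> undoes \<open>a\<close> and lands in \<open>1 - e\<close>, which is orthogonal
    to \<open>r\<close>.\<close>
  have "r * S * (1 - q') = r * S * (a * (1 - p)) * (1 - e) * T"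
    unfolding T(2)[symmetric] ape[symmetric] by (simp add: mult.assoc)
  also have "\<dots> = r * (S * (a * (1 - p))) * (1 - e) * T" by (simp only: mult.assoc)
  also have "\<dots> = r * ((1 - p) * (1 - e)) * T" unfolding S(4) by (simp only: mult.assoc)
  also have "(1 - p) * (1 - e) = 1 - e" by (simp add: right_diff_distrib left_diff_distrib pe)
  finally have rS0: "r * S * (1 - q') = 0" by (simp add: r)
  have "r * S * t = r * (S * (1 - q)) - r * S * (1 - q')"
    by (simp add: t_def right_diff_distrib mult.assoc)
  then have rSt: "r * S * t = r * S" by (simp add: rS0 S)
  have "r * S * (a * r) = r * (S * (a * (1 - p))) * r" by (simp add: mult.assoc r)
  then have 1: "r * S * (a * r) = r" unfolding S(4) by (simp add: mult.assoc r is_projD(2)[OF r(1)])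
  have "t * (a * (1 - e)) = (t * (1 - q')) * (a * (1 - e))" by (simp only: mult.assoc T(1))
  then have tae: "t * (a * (1 - e)) = 0" by (simp add: t)
  have "a * r = a * (1 - p) - a * (1 - e)" by (simp add: r_def right_diff_distrib)
  then have "t * (a * r) * S = t * (a * (1 - p) * S) - t * (a * (1 - e)) * S"
    by (simp add: right_diff_distrib left_diff_distrib mult.assoc)
  then have tS: "t * (a * r) * S = t" unfolding S(5) tae by (simp add: t)
  note rr = is_projD(2)[OF r(1)] and tt = is_projD(2)[OF t(1)]
  have "r * S * (t * (a * r)) = r * S * t * (a * r)" by (simp add: mult.assoc)
  moreover have "t * (a * r) * (r * S) = t * (a * r) * S"
    by (simp add: mult.assoc mult_eq_assoc[OF rr])
  ultimately have "corner_iso (t * (a * r)) (r * S) r t"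
    unfolding corner_iso_def rSt 1 tS
    by (simp add: mult.assoc rr tt mult_eq_assoc[OF rr] mult_eq_assoc[OF tt] rSt[unfolded mult.assoc])
  then have "mvn_equiv star t r" by (rule corner_iso_imp_mvn_equiv[OF t(1) r(1)])
  then have "cls t = cls r" using pclass_eq_iff rt by simp
  moreover have "cls e = cls p \<oplus> cls r" using padd_pclass[OF P(1) rt(1) r(2)] r by simp
  moreover have "cls q' = cls q \<oplus> cls t" using padd_pclass[OF P(3) rt(2) t(2)] t by simp
  ultimately show ?thesis using P rt by (simp add: padd_ac)
qed

text \<open>If \<open>p * (1 - p\<^sub>3)\<close> is small, then \<open>p\<^sub>3\<close> is equivalent to a projection \<open>e \<ge> p\<close>, and an
  element adapted to \<open>(e, q\<^sub>3)\<close> is by perturbation still invertible up to \<open>(p\<^sub>3, q\<^sub>3)\<close>.\<close>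

lemma inv_upto_near:
  assumes P: "p \<in> \<P>" "q \<in> \<P>" and inv: "inv_upto a p q"
  obtains \<delta> where "\<delta> > 0"
    "\<And>p\<^sub>3. p\<^sub>3 \<in> \<P> \<Longrightarrow> norm (p * (1 - p\<^sub>3)) < \<delta> \<Longrightarrow>
       \<exists>q\<^sub>3\<in>\<P>. inv_upto a p\<^sub>3 q\<^sub>3 \<and> cls p \<oplus> cls q\<^sub>3 = cls p\<^sub>3 \<oplus> cls q"
proof -
  obtain b where ab: "a * b - 1 \<in> F" using inv_upto_parametrix[OF P inv] by blast
  obtain q' where q': "q' \<in> \<P>" "adapted a p q'" using inv_upto_adapted[OF P inv] .
  have cq: "cls q = cls q'" by (rule pclass_eq_adapted[OF P q'(1) inv q'(2)])
  obtain S where "corner_iso (a * (1 - p)) S (1 - p) (1 - q')" using q' by (auto simp: adapted_def)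
  then have S: "S * (a * (1 - p)) = 1 - p" by (simp add: corner_iso_def)
  have pp: "is_proj star p" using P by (simp add: projF_iff)
  note p = is_projD(2)[OF pp] is_projD(2)[OF is_proj_one_minus[OF pp]]
  \<comment> \<open>The bound 1/2 yields \<open>norm d \<le> 2\<close> for the Neumann inverse
    below; the other factor makes the final perturbation \<open>norm y * norm (x - x')\<close>
    smaller than 1.\<close>
  define \<delta> where "\<delta> = 1 / (2 * (norm S * norm a + 1))"
  have \<delta>: "\<delta> > 0" "\<delta> \<le> 1/2" "2 * (norm S * norm a) * \<delta> < 1"
    by (auto simp: \<delta>_def divide_simps add_nonneg_pos mult_nonneg_nonneg)
  have "\<exists>q\<^sub>3\<in>\<P>. inv_upto a p\<^sub>3 q\<^sub>3 \<and> cls p \<oplus> cls q\<^sub>3 = cls p\<^sub>3 \<oplus> cls q"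
    if p3: "p\<^sub>3 \<in> \<P>" and small: "norm (p * (1 - p\<^sub>3)) < \<delta>" for p\<^sub>3
  proof -
    define k where "k = p * (1 - p\<^sub>3)"
    have k: "norm k < \<delta>" using small by (simp add: k_def)
    have pp3: "is_proj star p\<^sub>3" using p3 by (simp add: projF_iff)
    note p3' = is_projD(2)[OF pp3] is_projD(2)[OF is_proj_one_minus[OF pp3]]
    have "norm k < 1" using k \<delta> by simp
    then obtain d where d: "d * (1 - k) = 1" by (rule neumann_inverse)
    have nd: "norm d \<le> 2"
    proof -
      have "d = 1 + d * k" using d by (simp add: right_diff_distrib diff_eq_eq)
      then have "norm d \<le> norm (1::'a) + norm (d * k)" by (metis norm_triangle_ineq)
      also have "norm (d * k) \<le> norm d * (1/2)"
        using norm_mult_ineq[of d k] k \<delta>(2) mult_left_mono[of "norm k" "1/2" "norm d"] by auto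
      finally show ?thesis by simp
    qed
    \<comment> \<open>A small perturbation of \<open>1 - p\<^sub>3\<close> with range inside
      \<open>1 - p\<close>. Its range projection \<open>R\<close> lies below \<open>1 - p\<close>,
      so \<open>e = 1 - R\<close> dominates \<open>p\<close>.\<close>
    define c where "c = (1 - p) * (1 - p\<^sub>3)"
    have c_eq: "c = (1 - p\<^sub>3) - k" by (simp add: c_def k_def left_diff_distrib)
    have "k * (1 - p\<^sub>3) = k" by (simp add: k_def mult.assoc p3')
    then have c_k: "c = (1 - k) * (1 - p\<^sub>3)" by (simp add: c_eq left_diff_distrib)
    have "(1 - p\<^sub>3) * d * c = (1 - p\<^sub>3) * (d * (1 - k)) * (1 - p\<^sub>3)"
      unfolding c_k by (simp only: mult.assoc)
    then have dc: "(1 - p\<^sub>3) * d * c = 1 - p\<^sub>3" by (simp add: d p3')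
    have c3: "c * (1 - p\<^sub>3) = c" by (simp add: c_def mult.assoc p3')
    obtain R T where R: "is_proj star R" and iso_c: "corner_iso c T (1 - p\<^sub>3) R"
      using range_projection[OF dc c3] .
    have T: "R * c = c" "c * T = R" using iso_c by (auto simp: corner_iso_def)
    have pc: "(1 - p) * c = c" by (simp add: c_def p mult_eq_assoc[OF p(2)])
    then have pR: "(1 - p) * R = R" unfolding T(2)[symmetric] by (simp flip: mult.assoc)
    then have Rp: "R * (1 - p) = R"
      using is_proj_swap[OF is_proj_one_minus[OF pp] R] is_projD(1)[OF R] by simp
    define e where "e = 1 - R"
    have e: "is_proj star e" "1 - e = R" using is_proj_one_minus[OF R] by (simp_all add: e_def)
    have "R * (1 - p\<^sub>3) = R * (1 - p) * (1 - p\<^sub>3)" by (simp add: Rp)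
    also have "\<dots> = c" using T(1) by (simp add: c_def mult.assoc)
    finally have "corner_iso ((1 - e) * (1 - p\<^sub>3)) T (1 - p\<^sub>3) (1 - e)"
      using iso_c by (simp add: e)
    from pclass_eq_complement[OF e(1) p3 this]
    have eP: "e \<in> \<P>" and ce: "cls e = cls p\<^sub>3" .
    have pe: "p * e = p" using pR by (simp add: e_def left_diff_distrib right_diff_distrib)
    have "S * (a * (1 - e)) = S * (a * (1 - p)) * (1 - e)"
      by (simp add: e pR mult.assoc)
    then have "S * (a * (1 - e)) = 1 - e" by (simp add: S e pR)
    then have "(S * a - 1) * (1 - e) = 0" by (simp add: left_diff_distrib mult.assoc)
    then have "norm ((S * a - 1) * (1 - e)) < 1" by simp
    from adapted_exists[OF e(1) this] obtain q\<^sub>3 where q3: "is_proj star q\<^sub>3" "adapted a e q\<^sub>3" .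
    have q3P: "q\<^sub>3 \<in> \<P>" by (rule adapted_in_projF[OF eP q3 ab])
    obtain V where V: "corner_iso (a * (1 - e)) V (1 - e) (1 - q\<^sub>3)"
      using q3 by (auto simp: adapted_def)
    then have V': "(1 - q\<^sub>3) * (a * (1 - e)) = a * (1 - e)" by (simp add: corner_iso_def)
    define x where "x = a * (1 - e) * c"
    define y where "y = T * V"
    define x' where "x' = (1 - q\<^sub>3) * (a * (1 - p\<^sub>3))"
    have xy: "corner_iso x y (1 - p\<^sub>3) (1 - q\<^sub>3)"
      using corner_iso_trans[OF iso_c V[unfolded e(2)]] by (simp add: x_def y_def e)
    then have xy': "x * y = 1 - q\<^sub>3" "(1 - p\<^sub>3) * y = y" by (auto simp: corner_iso_def)
    have x: "x = a * c" by (simp add: x_def e mult.assoc T)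
    \<comment> \<open>There is no direct norm control on \<open>T\<close> and \<open>V\<close>;
      expressing \<open>y\<close> through \<open>d\<close> and \<open>S\<close> gives a bound that
      does not depend on \<open>p\<^sub>3\<close>.\<close>
    have "S * x = S * (a * (1 - p)) * c" unfolding x using pc by (simp add: mult.assoc)
    then have "S * x = c" by (simp add: S pc)
    then have "(1 - p\<^sub>3) * d * S * x = 1 - p\<^sub>3" using dc by (simp add: mult.assoc)
    then have "y = (1 - p\<^sub>3) * d * S * x * y" by (simp add: xy')
    also have "\<dots> = (1 - p\<^sub>3) * (d * S * (1 - q\<^sub>3))" by (simp add: mult.assoc xy')
    finally have y: "y = (1 - p\<^sub>3) * (d * S * (1 - q\<^sub>3))" .
    have n3: "norm (1 - p\<^sub>3) \<le> 1" "norm (1 - q\<^sub>3) \<le> 1"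
      by (intro norm_proj_le_1 is_proj_one_minus pp3 q3)+
    have "norm y \<le> norm (1 - p\<^sub>3) * (norm d * norm S * norm (1 - q\<^sub>3))"
      unfolding y by (meson mult_left_mono mult_right_mono norm_ge_zero norm_mult_ineq order.trans)
    also have "\<dots> \<le> 1 * (2 * norm S * 1)"
      using n3 nd by (intro mult_mono) auto
    finally have ny: "norm y \<le> 2 * norm S" by simp
    have "(1 - q\<^sub>3) * x = x" unfolding x_def using V' by (simp flip: mult.assoc)
    then have "x - x' = (1 - q\<^sub>3) * (a * (c - (1 - p\<^sub>3)))"
      unfolding x'_def x by (simp add: right_diff_distrib)
    then have "x - x' = - ((1 - q\<^sub>3) * (a * k))" by (simp add: c_eq)
    then have "norm (x - x') \<le> norm (1 - q\<^sub>3) * (norm a * norm k)"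
      by simp (meson mult_left_mono norm_ge_zero norm_mult_ineq order.trans)
    also have "\<dots> \<le> 1 * (norm a * \<delta>)"
      using n3 k by (intro mult_mono) auto
    finally have "norm y * norm (x - x') \<le> (2 * norm S) * (norm a * \<delta>)"
      using ny by (intro mult_mono) auto
    also have "\<dots> < 1" using \<delta>(3) by (simp add: mult.assoc)
    finally have lt: "norm y * norm (x - x') < 1" .
    have x': "(1 - q\<^sub>3) * x' = x'" "x' * (1 - p\<^sub>3) = x'"
      by (simp_all add: x'_def mult.assoc p3' mult_eq_assoc[OF is_projD(2)[OF is_proj_one_minus[OF q3(1)]]])
    obtain y' where "corner_iso x' y' (1 - p\<^sub>3) (1 - q\<^sub>3)"
      using corner_iso_perturb[OF xy x' lt] .
    then have "inv_upto a p\<^sub>3 q\<^sub>3" unfolding inv_upto_iff[OF pp3 q3(1)] x'_def by blast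
    moreover have "cls p \<oplus> cls q\<^sub>3 = cls p\<^sub>3 \<oplus> cls q"
      using adapted_mono[OF P(1) eP q'(1) q3P pe q'(2) q3(2)] by (simp add: ce cq)
    ultimately show ?thesis using q3P by blast
  qed
  with \<delta>(1) that show ?thesis by blast
qed

lemma inv_upto_pclass_unique:
  assumes "p \<in> \<P>" "q \<in> \<P>" "q' \<in> \<P>" "inv_upto a p q" "inv_upto a p q'"
  shows "cls q = cls q'"
proof -
  obtain r where r: "r \<in> \<P>" "adapted a p r" using inv_upto_adapted[OF assms(1,2,4)] .
  with assms show ?thesis using pclass_eq_adapted by metis
qed

text \<open>Both pairs are compared with pairs over one \<open>p\<^sub>3\<close> that nearly absorbs
  \<open>p\<close> and \<open>p'\<close>; over a common first entry the class of the second entry is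
  unique.\<close>

lemma kclass_inv_upto_unique:
  assumes P: "p \<in> \<P>" "q \<in> \<P>" "inv_upto a p q" and P': "p' \<in> \<P>" "q' \<in> \<P>" "inv_upto a p' q'"
  shows "kclass star F (cls p) (cls q) = kclass star F (cls p') (cls q')"
proof -
  obtain \<delta> where \<delta>: "\<delta> > 0" "\<And>p\<^sub>3. p\<^sub>3 \<in> \<P> \<Longrightarrow> norm (p * (1 - p\<^sub>3)) < \<delta> \<Longrightarrow>
       \<exists>q\<^sub>3\<in>\<P>. inv_upto a p\<^sub>3 q\<^sub>3 \<and> cls p \<oplus> cls q\<^sub>3 = cls p\<^sub>3 \<oplus> cls q"
    using inv_upto_near[OF P] by blast
  obtain \<epsilon> where \<epsilon>: "\<epsilon> > 0" "\<And>p\<^sub>3. p\<^sub>3 \<in> \<P> \<Longrightarrow> norm (p' * (1 - p\<^sub>3)) < \<epsilon> \<Longrightarrow>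
       \<exists>q\<^sub>3\<in>\<P>. inv_upto a p\<^sub>3 q\<^sub>3 \<and> cls p' \<oplus> cls q\<^sub>3 = cls p\<^sub>3 \<oplus> cls q'"
    using inv_upto_near[OF P'] by blast
  have "p \<in> F" "p' \<in> F" using P P' by (auto simp: projF_iff)
  then obtain p\<^sub>3 where p3: "p\<^sub>3 \<in> \<P>" "norm (p * (1 - p\<^sub>3)) < \<delta>" "norm (p' * (1 - p\<^sub>3)) < \<epsilon>"
    using approx_unit \<delta>(1) \<epsilon>(1) by metis
  obtain q\<^sub>3 where q3: "q\<^sub>3 \<in> \<P>" "inv_upto a p\<^sub>3 q\<^sub>3" "cls p \<oplus> cls q\<^sub>3 = cls p\<^sub>3 \<oplus> cls q"
    using \<delta>(2)[OF p3(1,2)] by blast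
  obtain q\<^sub>4 where q4: "q\<^sub>4 \<in> \<P>" "inv_upto a p\<^sub>3 q\<^sub>4" "cls p' \<oplus> cls q\<^sub>4 = cls p\<^sub>3 \<oplus> cls q'"
    using \<epsilon>(2)[OF p3(1,3)] by blast
  have "kclass star F (cls p) (cls q) = kclass star F (cls p\<^sub>3) (cls q\<^sub>3)"
    using P p3 q3 by (intro kclass_eqI') auto
  also have "cls q\<^sub>3 = cls q\<^sub>4" by (rule inv_upto_pclass_unique[OF p3(1) q3(1) q4(1) q3(2) q4(2)])
  also have "kclass star F (cls p\<^sub>3) (cls q\<^sub>4) = kclass star F (cls p') (cls q')"
    using P' p3 q4 by (intro kclass_eqI'[symmetric]) auto
  finally show ?thesis .
qed

lemma findex_eq:
  assumes "p \<in> \<P>" "q \<in> \<P>" "inv_upto a p q"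
  shows "findex star F a = kclass star F (cls p) (cls q)"
  unfolding findex_def
  by (rule some_equality) (use assms kclass_inv_upto_unique in blast)+

lemma findex_adapted:
  assumes "p \<in> \<P>" "q \<in> \<P>" "adapted a p q"
  shows "findex star F a = kclass star F (cls p) (cls q)"
  using assms adapted_imp_inv_upto by (intro findex_eq) (auto simp: projF_iff)

section \<open>The index of a product\<close>

text \<open>Go back from \<open>1 - r\<close> to \<open>1 - p\<close> by \<open>S\<close>, then
  forward by \<open>t\<^sub>1 * t\<^sub>2\<close>: the composite is
  \<open>t\<^sub>1 * (1 - r)\<close>.\<close>

lemma adapted_factor:
  assumes "adapted t\<^sub>2 p r" "adapted (t\<^sub>1 * t\<^sub>2) p q"
  shows "adapted t\<^sub>1 r q"
proof -
  obtain S where S: "corner_iso (t\<^sub>2 * (1 - p)) S (1 - p) (1 - r)"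
    using assms(1) by (auto simp: adapted_def)
  obtain T where T: "corner_iso (t\<^sub>1 * t\<^sub>2 * (1 - p)) T (1 - p) (1 - q)"
    using assms(2) by (auto simp: adapted_def)
  have "t\<^sub>1 * t\<^sub>2 * (1 - p) * S = t\<^sub>1 * (t\<^sub>2 * (1 - p) * S)" by (simp add: mult.assoc)
  also have "\<dots> = t\<^sub>1 * (1 - r)" using S by (simp add: corner_iso_def)
  finally show ?thesis
    using corner_iso_trans[OF corner_iso_sym[OF S] T] by (auto simp: adapted_def)
qed

lemma fredholm_index_mult:
  assumes "fredholm_type star F t\<^sub>1" "fredholm_type star F t\<^sub>2"
  shows "fredholm_type star F (t\<^sub>1 * t\<^sub>2) \<and>
    findex star F (t\<^sub>1 * t\<^sub>2) = kadd star F (findex star F t\<^sub>1) (findex star F t\<^sub>2)"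
proof -
  obtain p\<^sub>1 q\<^sub>1 where 1: "p\<^sub>1 \<in> \<P>" "q\<^sub>1 \<in> \<P>" "inv_upto t\<^sub>1 p\<^sub>1 q\<^sub>1"
    using assms(1) by (auto simp: fredholm_type_def)
  obtain p\<^sub>2 q\<^sub>2 where 2: "p\<^sub>2 \<in> \<P>" "q\<^sub>2 \<in> \<P>" "inv_upto t\<^sub>2 p\<^sub>2 q\<^sub>2"
    using assms(2) by (auto simp: fredholm_type_def)
  obtain b\<^sub>1 where b1: "b\<^sub>1 * t\<^sub>1 - 1 \<in> F" "t\<^sub>1 * b\<^sub>1 - 1 \<in> F"
    using inv_upto_parametrix[OF 1] by blast
  obtain b\<^sub>2 where b2: "b\<^sub>2 * t\<^sub>2 - 1 \<in> F" "t\<^sub>2 * b\<^sub>2 - 1 \<in> F"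
    using inv_upto_parametrix[OF 2] by blast
  \<comment> \<open>The error of \<open>b\<^sub>2 * b\<^sub>1\<close> as a left inverse of the
    product. It lies in the ideal, so the approximate unit makes it small on
    \<open>1 - p\<close>.\<close>
  define g where "g = b\<^sub>2 * b\<^sub>1 * (t\<^sub>1 * t\<^sub>2) - 1"
  have "g = b\<^sub>2 * (b\<^sub>1 * t\<^sub>1 - 1) * t\<^sub>2 + (b\<^sub>2 * t\<^sub>2 - 1)"
    by (simp add: g_def left_diff_distrib right_diff_distrib mult.assoc)
  moreover have "b\<^sub>2 * (b\<^sub>1 * t\<^sub>1 - 1) * t\<^sub>2 + (b\<^sub>2 * t\<^sub>2 - 1) \<in> F"
    by (intro F_add F_mult_left F_mult_right b1 b2)
  ultimately have g: "g \<in> F" by simp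
  have "t\<^sub>1 * t\<^sub>2 * (b\<^sub>2 * b\<^sub>1) - 1 = t\<^sub>1 * (t\<^sub>2 * b\<^sub>2 - 1) * b\<^sub>1 + (t\<^sub>1 * b\<^sub>1 - 1)"
    by (simp add: left_diff_distrib right_diff_distrib mult.assoc)
  moreover have "t\<^sub>1 * (t\<^sub>2 * b\<^sub>2 - 1) * b\<^sub>1 + (t\<^sub>1 * b\<^sub>1 - 1) \<in> F"
    by (intro F_add F_mult_left F_mult_right b1 b2)
  ultimately have right: "t\<^sub>1 * t\<^sub>2 * (b\<^sub>2 * b\<^sub>1) - 1 \<in> F" by (simp only:)
  obtain \<delta> where \<delta>: "\<delta> > 0" "\<And>p\<^sub>3. p\<^sub>3 \<in> \<P> \<Longrightarrow> norm (p\<^sub>2 * (1 - p\<^sub>3)) < \<delta> \<Longrightarrow>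
       \<exists>q\<^sub>3\<in>\<P>. inv_upto t\<^sub>2 p\<^sub>3 q\<^sub>3 \<and> cls p\<^sub>2 \<oplus> cls q\<^sub>3 = cls p\<^sub>3 \<oplus> cls q\<^sub>2"
    using inv_upto_near[OF 2] by blast
  have "p\<^sub>2 \<in> F" using 2 by (simp add: projF_iff)
  \<comment> \<open>The first estimate gives a range projection for
    \<open>t\<^sub>2 * (1 - p)\<close>, the second one for
    \<open>t\<^sub>1 * t\<^sub>2 * (1 - p)\<close>.\<close>
  then obtain p where p: "p \<in> \<P>" "norm (p\<^sub>2 * (1 - p)) < \<delta>" "norm (g * (1 - p)) < 1"
    using approx_unit[of p\<^sub>2 g \<delta> 1] g \<delta>(1) by auto
  obtain q\<^sub>3 where "q\<^sub>3 \<in> \<P>" "inv_upto t\<^sub>2 p q\<^sub>3" using \<delta>(2)[OF p(1,2)] by blast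
  then obtain r where r: "r \<in> \<P>" "adapted t\<^sub>2 p r" using inv_upto_adapted p(1) by blast
  have "is_proj star p" using p by (simp add: projF_iff)
  then obtain q where q: "is_proj star q" "adapted (t\<^sub>1 * t\<^sub>2) p q"
    using adapted_exists p(3) unfolding g_def by blast
  have qP: "q \<in> \<P>" by (rule adapted_in_projF[OF p(1) q right])
  have "adapted t\<^sub>1 r q" by (rule adapted_factor[OF r(2) q(2)])
  then have "kadd star F (findex star F t\<^sub>1) (findex star F t\<^sub>2) =
      kadd star F (kclass star F (cls r) (cls q)) (kclass star F (cls p) (cls r))"
    using p r qP by (simp add: findex_adapted)
  also have "\<dots> = kclass star F (cls r \<oplus> cls p) (cls q \<oplus> cls r)"
    using p r qP by (simp add: kadd_kclass)
  also have "\<dots> = kclass star F (cls p) (cls q)"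
    using p r qP by (intro kclass_eqI') (simp_all add: padd_ac)
  also have "\<dots> = findex star F (t\<^sub>1 * t\<^sub>2)"
    using p qP q by (simp add: findex_adapted)
  finally have "findex star F (t\<^sub>1 * t\<^sub>2) = kadd star F (findex star F t\<^sub>1) (findex star F t\<^sub>2)" ..
  moreover have "inv_upto (t\<^sub>1 * t\<^sub>2) p q"
    using p q by (simp add: projF_iff adapted_imp_inv_upto)
  ultimately show ?thesis using p(1) qP unfolding fredholm_type_def by blast
qed

end

theorem mainTheorem1:
  fixes star :: "'a::{real_normed_algebra_1,banach} \<Rightarrow> 'a"
    and F :: "'a set"
    and t1 t2 :: 'a
  assumes "cstar_algebra star"
    and "finite_type_alg star F"
    and "fredholm_type star F t1"
    and "fredholm_type star F t2"
  shows "fredholm_type star F (t1 * t2) \<and>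
         findex star F (t1 * t2) = kadd star F (findex star F t1) (findex star F t2)"
proof -
  interpret finite_type star F
    using assms(1,2) by unfold_locales
  show ?thesis by (rule fredholm_index_mult[OF assms(3,4)])
qed

end
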